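(* Let $S^n\subset\mathbb{E}^{n+1}$ be a piecewise flat submanifold with a dual tessellation into vertex regions $V_v$. For each vertex $v$, the average mean curvature over the dual $n$-volume $V_v$ is $$H_v := \widetilde H_{V_v} = \frac{1}{|V_v|}\sum_{h\subset\mathrm{star}(v)} |h_{|V_v}|\,\epsilon_h ,$$ where the sum is over the hinges $h$ in the star of $v$, $h_{|V_v}=h\cap V_v$ (with $|h_{|V_v}|$ its $(n-1)$-volume), $\epsilon_h$ is the hinge angle at $h$, and $|V_v|$ is the $n$-volume of $V_v$.
   Context: **Piecewise flat manifolds.** $\mathbb{E}^k$ is Euclidean $k$-space. A piecewise flat manifold $S^n$ is a manifold that is a homogeneous simplicial $n$-complex formed from Euclidean $n$-simplices glued along their $(n-1)$-faces with consistent metrics; it is a piecewise flat submanifold of $\mathbb{E}^{n+1}$ if it is embedded piecewise-linearly so that each simplex is flat. Simplices are open; the star of a simplex is the union of all simplices whose closure contains it. **Hinges and hinge angles.** A hinge $h$ is an $(n-1)$-simplex of $S^n$; it separates two $n$-simplices, and its star is intrinsically Euclidean. With a given orientation (choice of positive normal $\hat n$), the hinge angle is $\epsilon_h := \pi/2-\phi$, where $\phi$ is the angle between the positive normal to one of the two $n$-simplices and the inward-directed vector tangent to the other $n$-simplex and orthogonal to $h$. **Curvature integrals on $S^n$.** In the smooth case, $\alpha(u)=\langle\nabla_u u,\hat n\rangle$ with $\nabla$ the flat connection of $\mathbb{E}^{n+1}$, and the mean curvature is $H=\sum_i\alpha(e_i)$ for an orthonormal frame. On $S^n$ these are used only through integrals.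 For a geodesic segment $\gamma:[0,1]\to S^n$ (straight in each $n$-simplex and straight across hinges after unfolding) crossing a single hinge, $a_\gamma=\int_\gamma\alpha(\hat\gamma)\,\mathrm{d}s$ is the signed angle in $\mathbb{E}^{n+1}$ between its initial and final unit tangents $\hat\gamma_0,\hat\gamma_1$, positive if the normal component of $\hat\gamma_1-\hat\gamma_0$ is in the positive $\hat n$ direction and negative otherwise; it is $0$ if no hinge is crossed. For a unit vector field $e$ on a region $D$ whose integral curves are parallel geodesic lines, $\int_D\alpha(e)\,\mathrm{d}V^n$ is the integral of $a_\gamma$ over these lines $\gamma$ (restricted to $D$) with respect to the $(n-1)$-dimensional cross-sectional measure orthogonal to $e$. For $D\subset\mathrm{star}(h)$, $\int_D H\,\mathrm{d}V^n:=\sum_{i=1}^n\int_D\alpha(e_i)\,\mathrm{d}V^n$ for a Cartesian orthonormal frame $e_1,\dots,e_n$ on the intrinsically Euclidean $\mathrm{star}(h)$ with $e_1$ orthogonal to $h$; this is extended additively to regions decomposed into pieces each meeting at most one hinge. The average $\widetilde H_{V}$ over a region $V$ is $\frac1{|V|}\int_V H\,\mathrm{d}V^n$. **Vertex regions.** A dual tessellation is a decomposition of $S^n$ into $n$-dimensional regions $V_v$, one for each vertex $v$, such that: (1) $v\in V_v$ and no other vertex is in $V_v$; (2) the $V_v$ form a complete tessellation of $S^n$: $|S^n|=\sum_v|V_v|$ and $V_{v_i}\cap V_{v_j}=\emptyset$ for $i\neq j$; (3) only hinges in the star of $v$ intersect $V_v$.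
   Formalization: The angle φ in ε_h is measured in an oriented sense, from the normal through the continuation of the simplex, since with the unsigned angle the formula fails for bends beyond π/2 (e.g. a regular tetrahedron); the regions V_v are taken to be relatively open. *)

theory Defs
  imports "HOL-Analysis.Analysis"
begin

section \<open>Volumes of subsets of flats\<close>

definition orthonormal_frame ::
  "nat \<Rightarrow> 'a::euclidean_space set \<Rightarrow> 'a \<Rightarrow> (nat \<Rightarrow> 'a) \<Rightarrow> bool" where
  "orthonormal_frame k T p e \<longleftrightarrow>
     (\<forall>i<k. \<forall>j<k. e i \<bullet> e j = (if i = j then 1 else 0)) \<and>
     T = (\<lambda>w. p + w) ` span (e ` {..<k})"

(* k-dimensional Lebesgue measure of A, a subset of the k-dimensional affine subspace T, read off
   in orthonormal coordinates of T; the value does not depend on the coordinates.  For k = 0 this is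
   the counting measure on a point. *)
definition flat_volume :: "nat \<Rightarrow> 'a::euclidean_space set \<Rightarrow> 'a set \<Rightarrow> ennreal" where
  "flat_volume k T A = (THE m. \<exists>p e. orthonormal_frame k T p e \<and>
     m = emeasure (Pi\<^sub>M {..<k} (\<lambda>_. lborel))
           {x \<in> {..<k} \<rightarrow>\<^sub>E UNIV. p + (\<Sum>i<k. x i *\<^sub>R e i) \<in> A})"


section \<open>Piecewise flat submanifolds\<close>

(* Members of K are the closed simplices; the open simplex belonging to s is rel_interior s.
   As in HOL-Analysis, the empty face counts as a simplex of dimension -1. *)

definition k_simplices :: "'a::euclidean_space set set \<Rightarrow> nat \<Rightarrow> 'a set set" where
  "k_simplices K k = {s \<in> K. int k simplex s}"

definition vertices :: "'a::euclidean_space set set \<Rightarrow> 'a set" where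
  "vertices K = {v. {v} \<in> K}"

definition hinges :: "nat \<Rightarrow> 'a::euclidean_space set set \<Rightarrow> 'a set set" where
  "hinges n K = k_simplices K (n - 1)"

definition star :: "'a::euclidean_space set set \<Rightarrow> 'a set \<Rightarrow> 'a set" where
  "star K s = \<Union> {rel_interior t | t. t \<in> K \<and> s \<subseteq> t}"

definition hinges_in_star :: "nat \<Rightarrow> 'a::euclidean_space set set \<Rightarrow> 'a \<Rightarrow> 'a set set" where
  "hinges_in_star n K v = {h \<in> hinges n K. rel_interior h \<subseteq> star K {v}}"

(* The library's simplicial_complex with finiteness relaxed to local finiteness, so that
   noncompact submanifolds are included. *)
definition locally_finite_complex :: "'a::euclidean_space set set \<Rightarrow> bool" where
  "locally_finite_complex K \<longleftrightarrow>
     (\<forall>s \<in> K. \<exists>k. k simplex s) \<and>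
     (\<forall>f s. s \<in> K \<and> f face_of s \<longrightarrow> f \<in> K) \<and>
     (\<forall>s s'. s \<in> K \<and> s' \<in> K \<longrightarrow> (s \<inter> s') face_of s) \<and>
     (\<forall>x \<in> \<Union>K. \<exists>U. open U \<and> x \<in> U \<and> finite {s \<in> K. s \<inter> U \<noteq> {}})"

(* The two n-simplices separated by the hinge h, in either order. *)
definition hinge_pair ::
  "nat \<Rightarrow> 'a::euclidean_space set set \<Rightarrow> 'a set \<Rightarrow> 'a set \<Rightarrow> 'a set \<Rightarrow> bool" where
  "hinge_pair n K h s t \<longleftrightarrow> h \<in> hinges n K \<and> s \<noteq> t \<and> {u \<in> k_simplices K n. h \<subseteq> u} = {s, t}"

(* The submanifold is the union of K.  Its metric on every simplex is the one induced from the
   ambient Euclidean space, so metrics on common faces agree. *)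
definition piecewise_flat_submanifold :: "nat \<Rightarrow> (real ^ 'm) set set \<Rightarrow> bool" where
  "piecewise_flat_submanifold n K \<longleftrightarrow>
     CARD('m) = n + 1 \<and> locally_finite_complex K \<and>
     (\<forall>s \<in> K. \<exists>t \<in> k_simplices K n. s \<subseteq> t) \<and>
     (\<forall>h \<in> hinges n K. \<exists>s t. hinge_pair n K h s t) \<and>
     (\<forall>x \<in> \<Union>K. \<exists>U. openin (top_of_set (\<Union>K)) U \<and> x \<in> U \<and>
        top_of_set U homeomorphic_space Euclidean_space n)"

definition pf_volume :: "nat \<Rightarrow> 'a::euclidean_space set set \<Rightarrow> 'a set \<Rightarrow> ennreal" where
  "pf_volume n K A =
     (\<Sum>\<^sub>\<infinity>s \<in> k_simplices K n. flat_volume n (affine hull s) (A \<inter> rel_interior s))"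


section \<open>Normals and hinge angles\<close>

definition tangent_space :: "'a::euclidean_space set \<Rightarrow> 'a set" where
  "tangent_space s = span {x - y | x y. x \<in> s \<and> y \<in> s}"

(* The unit vector tangent to s, orthogonal to its facet h and pointing from h into s. *)
definition inward :: "'a::euclidean_space set \<Rightarrow> 'a set \<Rightarrow> 'a" where
  "inward h s = (THE u. norm u = 1 \<and> u \<in> tangent_space s \<and> (\<forall>w \<in> tangent_space h. u \<bullet> w = 0) \<and>
     (\<exists>x \<in> rel_interior h. \<exists>r>0. x + r *\<^sub>R u \<in> rel_interior s))"

(* N chooses a unit normal of every n-simplex.  Compatibility across a hinge: the rotation about
   the hinge which continues s straight into t carries the normal of s to that of t. *)
definition positive_normal ::
  "nat \<Rightarrow> (real ^ 'm) set set \<Rightarrow> ((real ^ 'm) set \<Rightarrow> real ^ 'm) \<Rightarrow> bool" where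
  "positive_normal n K N \<longleftrightarrow>
     (\<forall>s \<in> k_simplices K n. norm (N s) = 1 \<and> (\<forall>w \<in> tangent_space s. N s \<bullet> w = 0)) \<and>
     (\<forall>h s t. hinge_pair n K h s t \<longrightarrow>
        (\<exists>Q. rotation_matrix Q \<and> (\<forall>w \<in> tangent_space h. Q *v w = w) \<and>
             Q *v (- inward h s) = inward h t \<and> Q *v N s = N t))"

(* The angle from c to b in the plane of the orthonormal pair c, w, measured in the sense from c
   to w and cut at -w. *)
definition angle_through :: "'a::euclidean_space \<Rightarrow> 'a \<Rightarrow> 'a \<Rightarrow> real" where
  "angle_through c w b = (THE \<phi>. - (pi / 2) \<le> \<phi> \<and> \<phi> < 3 * pi / 2 \<and> b = cos \<phi> *\<^sub>R c + sin \<phi> *\<^sub>R w)"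

(* On the half plane of w, angle_through is the ordinary unsigned angle. *)
lemma angle_through_eq_arccos:
  fixes c w b :: "'a::euclidean_space"
  assumes "norm c = 1" "norm w = 1" "c \<bullet> w = 0" "norm b = 1"
    and b: "b = x *\<^sub>R c + y *\<^sub>R w" and y: "y \<ge> 0"
  shows "angle_through c w b = arccos (c \<bullet> b)"
proof -
  have ip: "c \<bullet> c = 1" "w \<bullet> w = 1" "w \<bullet> c = 0" "b \<bullet> b = 1"
    using assms by (simp_all add: norm_eq_1 inner_commute)
  have xy: "x\<^sup>2 + y\<^sup>2 = 1"
    using ip(4) by (simp add: b inner_add_left inner_add_right ip assms(3) power2_eq_square)
  have cb: "c \<bullet> b = x"
    by (simp add: b inner_add_right ip assms(3))
  have "x\<^sup>2 \<le> 1" using xy by (smt (verit) zero_le_power2)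
  then have x1: "- 1 \<le> x" "x \<le> 1" by (simp_all add: abs_square_le_1 abs_le_iff)
  have "y = sqrt (1 - x\<^sup>2)" using xy y by (metis add_diff_cancel_left' real_sqrt_abs abs_of_nonneg)
  then have sx: "sin (arccos x) = y" using x1 by (simp add: sin_arccos)
  show ?thesis unfolding angle_through_def cb
  proof (rule the_equality)
    show "- (pi / 2) \<le> arccos x \<and> arccos x < 3 * pi / 2 \<and>
        b = cos (arccos x) *\<^sub>R c + sin (arccos x) *\<^sub>R w"
    proof (intro conjI)
      show "- (pi / 2) \<le> arccos x" using arccos_lbound[OF x1] pi_gt_zero by linarith
      show "arccos x < 3 * pi / 2" using arccos_ubound[OF x1] pi_gt_zero by linarith
      show "b = cos (arccos x) *\<^sub>R c + sin (arccos x) *\<^sub>R w" using x1 sx b by simp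
    qed
  next
    fix \<phi> assume \<phi>: "- (pi / 2) \<le> \<phi> \<and> \<phi> < 3 * pi / 2 \<and> b = cos \<phi> *\<^sub>R c + sin \<phi> *\<^sub>R w"
    then have bb: "b = cos \<phi> *\<^sub>R c + sin \<phi> *\<^sub>R w" by blast
    have cx: "cos \<phi> = x"
      using cb by (simp add: bb inner_add_right ip assms(3))
    have "w \<bullet> b = y" by (simp add: b inner_add_right ip)
    then have sy: "sin \<phi> = y" by (simp add: bb inner_add_right ip)
    have "0 \<le> \<phi>"
    proof (rule ccontr)
      assume "\<not> 0 \<le> \<phi>"
      then have "0 < sin (- \<phi>)" using \<phi> pi_gt_zero by (intro sin_gt_zero) auto
      then show False using sy y by simp
    qed
    moreover have "\<phi> \<le> pi"
    proof (rule ccontr)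
      assume "\<not> \<phi> \<le> pi"
      then have "0 < sin (\<phi> - pi)" using \<phi> pi_gt_zero by (intro sin_gt_zero) auto
      then show False using sy y by simp
    qed
    ultimately show "\<phi> = arccos x" using cx arccos_cos by metis
  qed
qed

(* phi is measured from the normal of s through the continuation of s across h to the inward
   vector of t.  The unsigned angle would agree as long as the surface bends by at most pi/2 at h
   (angle_through_eq_arccos), but for sharper folds pi/2 - phi would no longer be the angle by
   which the tangent turns.  Exchanging s and t gives the same value. *)
definition hinge_angle ::
  "nat \<Rightarrow> (real ^ 'm) set set \<Rightarrow> ((real ^ 'm) set \<Rightarrow> real ^ 'm) \<Rightarrow> (real ^ 'm) set \<Rightarrow> real" where
  "hinge_angle n K N h = (THE \<epsilon>. \<exists>s t. hinge_pair n K h s t \<and>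
     \<epsilon> = pi / 2 - angle_through (N s) (- inward h s) (inward h t))"


section \<open>Mean curvature integrals\<close>

(* The inverse of unfolding the star of h into the hyperplane affine hull s: the half hyperplane
   containing s is kept, the other one is turned about h onto the half hyperplane containing t.
   Here p is any point of affine hull h.  Geodesics of the star are the images of straight lines. *)
definition fold_star ::
  "'a::euclidean_space set \<Rightarrow> 'a set \<Rightarrow> 'a set \<Rightarrow> 'a \<Rightarrow> 'a \<Rightarrow> 'a" where
  "fold_star h s t p x =
     (let r = (x - p) \<bullet> inward h s
      in if r \<ge> 0 then x else x - r *\<^sub>R inward h s + \<bar>r\<bar> *\<^sub>R inward h t)"

(* The first vector of the frame has index 0. *)
definition hinge_frame ::
  "nat \<Rightarrow> 'a::euclidean_space set \<Rightarrow> 'a set \<Rightarrow> 'a \<Rightarrow> (nat \<Rightarrow> 'a) \<Rightarrow> bool" where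
  "hinge_frame n h s p e \<longleftrightarrow> orthonormal_frame n (affine hull s) p e \<and> p \<in> affine hull h \<and>
     (\<forall>w \<in> tangent_space h. e 0 \<bullet> w = 0)"

definition initial_tangent :: "(real \<Rightarrow> 'a::euclidean_space) \<Rightarrow> real set \<Rightarrow> 'a" where
  "initial_tangent \<gamma> I = Lim (at_right (Inf I)) (\<lambda>r. vector_derivative \<gamma> (at r))"

definition final_tangent :: "(real \<Rightarrow> 'a::euclidean_space) \<Rightarrow> real set \<Rightarrow> 'a" where
  "final_tangent \<gamma> I = Lim (at_left (Sup I)) (\<lambda>r. vector_derivative \<gamma> (at r))"

(* c is a vector in the direction of the positive normal. *)
definition signed_angle :: "'a::euclidean_space \<Rightarrow> 'a \<Rightarrow> 'a \<Rightarrow> real" where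
  "signed_angle c a b = (if (b - a) \<bullet> c > 0 then arccos (a \<bullet> b) else - arccos (a \<bullet> b))"

(* The curvature a of the unit speed geodesic segment given by the restriction of gamma to the
   interval I, running in the star of h.  The normal at the hinge is the bisector of the normals of
   the two n-simplices; the difference of the tangents of a segment orthogonal to h is a multiple
   of it. *)
definition segment_curvature ::
  "('a::euclidean_space set \<Rightarrow> 'a) \<Rightarrow> 'a set \<Rightarrow> 'a set \<Rightarrow> 'a set \<Rightarrow> (real \<Rightarrow> 'a) \<Rightarrow> real set \<Rightarrow> real"
where
  "segment_curvature N h s t \<gamma> I =
     (if \<gamma> ` I \<inter> rel_interior h = {} then 0
      else signed_angle (N s + N t) (initial_tangent \<gamma> I) (final_tangent \<gamma> I))"

definition frame_line ::
  "nat \<Rightarrow> 'a::euclidean_space \<Rightarrow> (nat \<Rightarrow> 'a) \<Rightarrow> nat \<Rightarrow> (nat \<Rightarrow> real) \<Rightarrow> real \<Rightarrow> 'a" where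
  "frame_line n p e i y r = p + (\<Sum>j \<in> {..<n} - {i}. y j *\<^sub>R e j) + r *\<^sub>R e i"

(* Integral over D, contained in the star of h, of alpha of the i-th frame field.  The lines are
   parametrised by their coordinates y in the orthogonal cross-section; a line may meet D in
   several segments, the connected components. *)
definition alpha_integral ::
  "nat \<Rightarrow> ('a::euclidean_space set \<Rightarrow> 'a) \<Rightarrow> 'a set \<Rightarrow> 'a set \<Rightarrow> 'a set \<Rightarrow> 'a \<Rightarrow> (nat \<Rightarrow> 'a)
     \<Rightarrow> nat \<Rightarrow> 'a set \<Rightarrow> real" where
  "alpha_integral n N h s t p e i D =
     (\<integral>y. (\<Sum>\<^sub>\<infinity>I \<in> components {r. fold_star h s t p (frame_line n p e i y r) \<in> D}.
             segment_curvature N h s t (\<lambda>r. fold_star h s t p (frame_line n p e i y r)) I)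
        \<partial>(Pi\<^sub>M ({..<n} - {i}) (\<lambda>_. lborel)))"

(* No geodesic in a region that meets no hinge crosses a hinge, whence the second alternative. *)
definition has_piece_integral ::
  "nat \<Rightarrow> (real ^ 'm) set set \<Rightarrow> ((real ^ 'm) set \<Rightarrow> real ^ 'm) \<Rightarrow> (real ^ 'm) set \<Rightarrow> real \<Rightarrow> bool"
where
  "has_piece_integral n K N D I \<longleftrightarrow>
     (\<exists>h s t p e. hinge_pair n K h s t \<and> hinge_frame n h s p e \<and> D \<subseteq> star K h \<and>
        I = (\<Sum>i<n. alpha_integral n N h s t p e i D)) \<or>
     ((\<forall>h \<in> hinges n K. D \<inter> rel_interior h = {}) \<and> I = 0)"

(* Additive extension.  The pieces cover A up to a set which is null in the n-volume and also null
   in every hinge: the curvature is concentrated on the hinges, so a decomposition must not cut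
   along them. *)
definition has_mean_curvature_integral ::
  "nat \<Rightarrow> (real ^ 'm) set set \<Rightarrow> ((real ^ 'm) set \<Rightarrow> real ^ 'm) \<Rightarrow> (real ^ 'm) set \<Rightarrow> real \<Rightarrow> bool"
where
  "has_mean_curvature_integral n K N A I \<longleftrightarrow>
     (\<exists>\<D> c. finite \<D> \<and> disjoint \<D> \<and> \<Union>\<D> \<subseteq> A \<and>
        (\<forall>D \<in> \<D>. openin (top_of_set (\<Union>K)) D \<and> has_piece_integral n K N D (c D)) \<and>
        pf_volume n K (A - \<Union>\<D>) = 0 \<and>
        (\<forall>h \<in> hinges n K.
           flat_volume (n - 1) (affine hull h) (rel_interior h \<inter> (A - \<Union>\<D>)) = 0) \<and>
        I = (\<Sum>D \<in> \<D>. c D))"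

definition mean_curvature_integral ::
  "nat \<Rightarrow> (real ^ 'm) set set \<Rightarrow> ((real ^ 'm) set \<Rightarrow> real ^ 'm) \<Rightarrow> (real ^ 'm) set \<Rightarrow> real" where
  "mean_curvature_integral n K N A = (THE I. has_mean_curvature_integral n K N A I)"

definition average_mean_curvature ::
  "nat \<Rightarrow> (real ^ 'm) set set \<Rightarrow> ((real ^ 'm) set \<Rightarrow> real ^ 'm) \<Rightarrow> (real ^ 'm) set \<Rightarrow> real" where
  "average_mean_curvature n K N A =
     1 / enn2real (pf_volume n K A) * mean_curvature_integral n K N A"


section \<open>Dual tessellations\<close>

(* Regions are open subsets of the submanifold; being disjoint, they exhaust it in volume, the
   common boundaries belonging to none of them. *)
definition dual_tessellation ::
  "nat \<Rightarrow> 'a::euclidean_space set set \<Rightarrow> ('a \<Rightarrow> 'a set) \<Rightarrow> bool" where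
  "dual_tessellation n K V \<longleftrightarrow>
     (\<forall>v \<in> vertices K. openin (top_of_set (\<Union>K)) (V v)) \<and>
     (\<forall>v \<in> vertices K. V v \<inter> vertices K = {v}) \<and>
     pf_volume n K (\<Union>K) = (\<Sum>\<^sub>\<infinity>v \<in> vertices K. pf_volume n K (V v)) \<and>
     (\<forall>v \<in> vertices K. \<forall>w \<in> vertices K. v \<noteq> w \<longrightarrow> V v \<inter> V w = {}) \<and>
     (\<forall>v \<in> vertices K. \<forall>h \<in> hinges n K.
        V v \<inter> rel_interior h \<noteq> {} \<longrightarrow> h \<in> hinges_in_star n K v)"

end

(* Only the direction orthogonal to a hinge contributes to the curvature integral of a piece in the
   star of that hinge: lines parallel to the hinge avoid it for almost all positions, while a line
   orthogonal to it crosses it exactly when its foot lies in the piece, turning by the hinge angle.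
   That this turning angle, a signed arccos, equals pi/2 - phi uses that the normals are carried into
   each other by a proper rotation and that the two simplices are not folded onto each other.
   Hence every piece D contributes the sum of |h Int D| eps_h over all hinges, which is additive in
   D, so every admissible decomposition of the vertex region gives the same value. A decomposition
   exists: cut every n-simplex at v along the bisecting hyperplanes of its facets through v. *)

theory Submission
  imports Defs
begin

section \<open>Invariance of flat volumes under change of frame\<close>

text \<open>\<open>flat_volume\<close>, \<open>hinge_angle\<close> and
  \<open>mean_curvature_integral\<close> are definite descriptions, so each owes a proof of
  existence and uniqueness before it can be computed. For volumes the description ranges over all
  sets, so independence of the frame must also hold where the coordinate set is not measurable and
  \<open>emeasure\<close> is 0 by default. For Borel sets the comparison is that of Haar measures on
  the direction space, normalised by the unit ball. For the hinge angle the two orders of the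
  simplices must agree; reversing a geodesic settles this. For the curvature integral, the pieces
  are open but otherwise uncontrolled: a line may meet one of them in infinitely many segments, of
  which only the one through the hinge counts. An admissible decomposition must be finite and open
  and may not cut along a hinge. Bisectors achieve this because on an open facet its own height is
  zero while the heights over the other facets are positive. A vertex region may also reach into
  simplices none of whose facets is a hinge at the vertex; their interiors meet no hinge and
  together form one further piece.\<close>

interpretation lborel_product: product_sigma_finite "\<lambda>i. lborel :: real measure"
  by standard

text \<open>Lebesgue measure on a finite product is determined by its values on boxes, and the
  preimage of a box under a translation is a box with translated sides.\<close>

lemma PiM_lborel_translate:
  fixes a :: "'i \<Rightarrow> real"
  assumes "finite I"
  shows "distr (Pi\<^sub>M I (\<lambda>_. lborel)) (Pi\<^sub>M I (\<lambda>_. lborel)) (\<lambda>x. \<lambda>i\<in>I. x i + a i) = Pi\<^sub>M I (\<lambda>_. lborel)"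
proof (rule lborel_product.PiM_eqI[OF assms])
  let ?M = "Pi\<^sub>M I (\<lambda>_. lborel :: real measure)"
  fix A :: "'i \<Rightarrow> real set" assume A: "\<And>i. i \<in> I \<Longrightarrow> A i \<in> sets lborel"
  have tr: "(\<lambda>t. t + a i) -` A i \<in> sets lborel" "emeasure lborel ((\<lambda>t. t + a i) -` A i) = emeasure lborel (A i)"
    if "i \<in> I" for i
  proof -
    have m: "(\<lambda>t. t + a i) \<in> borel_measurable lborel" by measurable
    show "(\<lambda>t. t + a i) -` A i \<in> sets lborel" using measurable_sets[OF m, of "A i"] A[OF that] by simp
    have eq: "(+) (a i) = (\<lambda>t. t + a i)" by (auto simp: add.commute)
    have "emeasure lborel (A i) = emeasure (distr lborel borel (\<lambda>t. t + a i)) (A i)"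
      using lborel_distr_plus[of "a i"] unfolding eq by simp
    also have "\<dots> = emeasure lborel ((\<lambda>t. t + a i) -` A i)"
      using A[OF that] m by (subst emeasure_distr) auto
    finally show "emeasure lborel ((\<lambda>t. t + a i) -` A i) = emeasure lborel (A i)" by simp
  qed
  have m: "(\<lambda>x. \<lambda>i\<in>I. x i + a i) \<in> measurable ?M ?M" by measurable
  have "emeasure (distr ?M ?M (\<lambda>x. \<lambda>i\<in>I. x i + a i)) (Pi\<^sub>E I A)
      = emeasure ?M ((\<lambda>x. \<lambda>i\<in>I. x i + a i) -` Pi\<^sub>E I A \<inter> space ?M)"
    using A m assms by (intro emeasure_distr) (auto intro!: sets_PiM_I_finite)
  also have "(\<lambda>x. \<lambda>i\<in>I. x i + a i) -` Pi\<^sub>E I A \<inter> space ?M = Pi\<^sub>E I (\<lambda>i. (\<lambda>t. t + a i) -` A i)"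
    by (auto simp: space_PiM PiE_iff restrict_def extensional_def)
  also have "emeasure ?M \<dots> = (\<Prod>i\<in>I. emeasure lborel (A i))"
    using assms tr by (subst lborel_product.emeasure_PiM) auto
  finally show "emeasure (distr ?M ?M (\<lambda>x. \<lambda>i\<in>I. x i + a i)) (Pi\<^sub>E I A) = (\<Prod>i\<in>I. emeasure lborel (A i))" .
qed simp

section \<open>Orthonormal families and the measure on their span\<close>

definition orthonormal_family :: "nat \<Rightarrow> (nat \<Rightarrow> 'a::euclidean_space) \<Rightarrow> bool" where
  "orthonormal_family k e \<longleftrightarrow> (\<forall>i<k. \<forall>j<k. e i \<bullet> e j = (if i = j then 1 else 0))"

lemma orthonormal_family_inner_sum:
  assumes "orthonormal_family k e" "i < k"
  shows "(\<Sum>j<k. x j *\<^sub>R e j) \<bullet> e i = x i"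
proof -
  have "(\<Sum>j<k. x j *\<^sub>R e j) \<bullet> e i = (\<Sum>j<k. if j = i then x j else 0)"
    unfolding inner_sum_left using assms by (intro sum.cong) (auto simp: orthonormal_family_def)
  also have "\<dots> = x i" using assms by simp
  finally show ?thesis .
qed

lemma frame_sum_span: "(\<Sum>i<k. x i *\<^sub>R e i) \<in> span (e ` {..<k})"
  by (intro span_sum span_mul span_base) auto

text \<open>The difference of the two sides lies in the span and is orthogonal to every member of
  the family, hence to itself.\<close>

lemma orthonormal_family_expand:
  assumes "orthonormal_family k e" "w \<in> span (e ` {..<k})"
  shows "(\<Sum>i<k. (w \<bullet> e i) *\<^sub>R e i) = w"
proof -
  let ?z = "(\<Sum>i<k. (w \<bullet> e i) *\<^sub>R e i)"
  have "?z \<in> span (e ` {..<k})" by (intro span_sum span_mul span_base) auto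
  then have d: "w - ?z \<in> span (e ` {..<k})" using assms(2) by (rule span_diff[rotated])
  have "(w - ?z) \<bullet> x = 0" if "x \<in> span (e ` {..<k})" for x
    using that
  proof (induction rule: span_induct_alt)
    case base then show ?case by simp
  next
    case (step c x y)
    then obtain i where "i < k" "x = e i" by auto
    then show ?case
      using step orthonormal_family_inner_sum[OF assms(1) \<open>i < k\<close>, of "\<lambda>j. w \<bullet> e j"]
      by (simp add: inner_add_right inner_diff_left)
  qed
  from this[OF d] show ?thesis by simp
qed

lemma orthonormal_family_norm:
  assumes "orthonormal_family k e"
  shows "norm (\<Sum>j<k. x j *\<^sub>R e j) = sqrt (\<Sum>j<k. (x j)\<^sup>2)"
  unfolding norm_eq_sqrt_inner inner_sum_right
  using orthonormal_family_inner_sum[OF assms] by (auto simp: power2_eq_square intro!: sum.cong)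

text \<open>Adding \<open>w\<close> shifts the i-th coordinate by \<open>w \<bullet> e i\<close>,
  which is a translation of the coordinate space.\<close>

lemma nn_integral_frame_translate:
  fixes f :: "'a::euclidean_space \<Rightarrow> ennreal"
  assumes e: "orthonormal_family k e" and w: "w \<in> span (e ` {..<k})"
    and f[measurable]: "f \<in> borel_measurable borel"
  shows "(\<integral>\<^sup>+x. f (\<Sum>i<k. x i *\<^sub>R e i) \<partial>Pi\<^sub>M {..<k} (\<lambda>_. lborel)) =
         (\<integral>\<^sup>+x. f ((\<Sum>i<k. x i *\<^sub>R e i) + w) \<partial>Pi\<^sub>M {..<k} (\<lambda>_. lborel))"
proof -
  let ?M = "Pi\<^sub>M {..<k} (\<lambda>_. lborel :: real measure)"
  let ?C = "\<lambda>x. \<lambda>i\<in>{..<k}. x i + w \<bullet> e i"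
  have m: "?C \<in> measurable ?M ?M" by measurable
  have g: "(\<lambda>x. f (\<Sum>i<k. x i *\<^sub>R e i)) \<in> borel_measurable ?M" by measurable
  have "(\<integral>\<^sup>+x. f (\<Sum>i<k. x i *\<^sub>R e i) \<partial>?M) = (\<integral>\<^sup>+x. f (\<Sum>i<k. x i *\<^sub>R e i) \<partial>distr ?M ?M ?C)"
    by (subst PiM_lborel_translate) auto
  also have "\<dots> = (\<integral>\<^sup>+x. f (\<Sum>i<k. ?C x i *\<^sub>R e i) \<partial>?M)"
    using m g by (intro nn_integral_distr) auto
  also have "\<dots> = (\<integral>\<^sup>+x. f ((\<Sum>i<k. x i *\<^sub>R e i) + w) \<partial>?M)"
  proof (rule nn_integral_cong)
    fix x
    have "(\<Sum>i<k. ?C x i *\<^sub>R e i) = (\<Sum>i<k. x i *\<^sub>R e i) + (\<Sum>i<k. (w \<bullet> e i) *\<^sub>R e i)"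
      by (simp add: scaleR_add_left sum.distrib)
    then show "f (\<Sum>i<k. ?C x i *\<^sub>R e i) = f ((\<Sum>i<k. x i *\<^sub>R e i) + w)"
      by (simp add: orthonormal_family_expand[OF e w])
  qed
  finally show ?thesis .
qed

text \<open>The k-dimensional Lebesgue measure of the span, regarded as a Borel measure on the whole
  space so that different frames can be compared directly.\<close>

definition frame_measure :: "nat \<Rightarrow> (nat \<Rightarrow> 'a::euclidean_space) \<Rightarrow> 'a measure" where
  "frame_measure k e = distr (Pi\<^sub>M {..<k} (\<lambda>_. lborel)) borel (\<lambda>x. \<Sum>i<k. x i *\<^sub>R e i)"

lemma sets_frame_measure [simp]: "sets (frame_measure k e) = sets borel"
  by (simp add: frame_measure_def)

lemma emeasure_frame_measure:
  assumes "A \<in> sets borel"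
  shows "emeasure (frame_measure k e) A =
    emeasure (Pi\<^sub>M {..<k} (\<lambda>_. lborel)) {x \<in> {..<k} \<rightarrow>\<^sub>E UNIV. (\<Sum>i<k. x i *\<^sub>R e i) \<in> A}"
  unfolding frame_measure_def using assms
  by (subst emeasure_distr) (auto simp: space_PiM intro!: arg_cong[where f="emeasure _"])

lemma emeasure_frame_measure_nn_integral:
  assumes [measurable]: "A \<in> sets borel"
  shows "emeasure (frame_measure k e) A =
    (\<integral>\<^sup>+x. indicator A (\<Sum>i<k. x i *\<^sub>R e i) \<partial>Pi\<^sub>M {..<k} (\<lambda>_. lborel))"
proof -
  have "emeasure (frame_measure k e) A = (\<integral>\<^sup>+x. indicator A x \<partial>frame_measure k e)"
    using assms by (subst nn_integral_indicator) auto
  also have "\<dots> = (\<integral>\<^sup>+x. indicator A (\<Sum>i<k. x i *\<^sub>R e i) \<partial>Pi\<^sub>M {..<k} (\<lambda>_. lborel))"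
    unfolding frame_measure_def by (subst nn_integral_distr) auto
  finally show ?thesis .
qed

text \<open>Both measures are invariant under translations along the common span, so Fubini and two shifts
  compare them as in the proof that Haar measure is unique.\<close>
lemma frame_measure_exchange:
  fixes e e' :: "nat \<Rightarrow> 'a::euclidean_space"
  assumes e: "orthonormal_family k e" "orthonormal_family k e'"
    and sp: "span (e ` {..<k}) = span (e' ` {..<k})"
    and A[measurable]: "A \<in> sets borel" and B[measurable]: "B \<in> sets borel"
  shows "emeasure (frame_measure k e) A * emeasure (frame_measure k e') B =
         emeasure (frame_measure k e) (uminus -` B) * emeasure (frame_measure k e') A"
proof -
  let ?M = "Pi\<^sub>M {..<k} (\<lambda>_. lborel :: real measure)"
  define F where "F x = (\<Sum>i<k. x i *\<^sub>R e i)" for x :: "nat \<Rightarrow> real"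
  define G where "G x = (\<Sum>i<k. x i *\<^sub>R e' i)" for x :: "nat \<Rightarrow> real"
  have F[measurable]: "F \<in> measurable ?M borel" unfolding F_def by measurable
  have G[measurable]: "G \<in> measurable ?M borel" unfolding G_def by measurable
  have Fs: "F x \<in> span (e ` {..<k})" for x unfolding F_def by (intro span_sum span_mul span_base) auto
  have Gs: "G x \<in> span (e ` {..<k})" for x unfolding G_def sp by (intro span_sum span_mul span_base) auto
  have mB[measurable]: "uminus -` B \<in> sets borel"
    using measurable_sets[of uminus borel borel B] B by simp
  interpret finite_product_sigma_finite "\<lambda>i. lborel :: real measure" "{..<k}" by standard simp
  interpret P: pair_sigma_finite ?M ?M by standard
  have shG: "(\<integral>\<^sup>+y. f (G y) \<partial>?M) = (\<integral>\<^sup>+y. f (G y + w) \<partial>?M)"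
    if "f \<in> borel_measurable borel" "w \<in> span (e ` {..<k})" for f :: "'a \<Rightarrow> ennreal" and w
    using nn_integral_frame_translate[OF e(2), of w f] that unfolding sp G_def by simp
  have shF: "(\<integral>\<^sup>+y. f (F y) \<partial>?M) = (\<integral>\<^sup>+y. f (F y + w) \<partial>?M)"
    if "f \<in> borel_measurable borel" "w \<in> span (e ` {..<k})" for f :: "'a \<Rightarrow> ennreal" and w
    using nn_integral_frame_translate[OF e(1), of w f] that unfolding F_def by simp
  have "emeasure (frame_measure k e) A * emeasure (frame_measure k e') B =
      (\<integral>\<^sup>+x. indicator A (F x) * (\<integral>\<^sup>+y. indicator B (G y) \<partial>?M) \<partial>?M)"
    unfolding emeasure_frame_measure_nn_integral[OF A] emeasure_frame_measure_nn_integral[OF B] F_def[symmetric] G_def[symmetric]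
    by (rule nn_integral_multc[symmetric]) measurable
  also have "\<dots> = (\<integral>\<^sup>+x. (\<integral>\<^sup>+y. indicator A (F x) * indicator B (G y - F x) \<partial>?M) \<partial>?M)"
  proof (rule nn_integral_cong)
    fix x
    have "(\<integral>\<^sup>+y. indicator B (G y) \<partial>?M) = (\<integral>\<^sup>+y. indicator B (G y + (- F x)) \<partial>?M)"
      by (rule shG) (auto simp: Fs span_neg)
    then show "indicator A (F x) * (\<integral>\<^sup>+y. indicator B (G y) \<partial>?M) = (\<integral>\<^sup>+y. indicator A (F x) * indicator B (G y - F x) \<partial>?M)"
      by (subst nn_integral_cmult) auto
  qed
  also have "\<dots> = (\<integral>\<^sup>+y. (\<integral>\<^sup>+x. indicator A (F x) * indicator B (G y - F x) \<partial>?M) \<partial>?M)"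
    by (rule P.Fubini') measurable
  \<comment> \<open>Moving \<open>x\<close> by \<open>G y\<close> turns the argument
    \<open>G y - F x\<close> of \<open>B\<close> into \<open>- F x\<close>, so \<open>y\<close>
    survives only in the first factor. This is why \<open>B\<close> comes out reflected.\<close>
  also have "\<dots> = (\<integral>\<^sup>+y. (\<integral>\<^sup>+x. indicator A (F x + G y) * indicator B (- F x) \<partial>?M) \<partial>?M)"
  proof (rule nn_integral_cong)
    fix y
    have "(\<integral>\<^sup>+x. indicator A (F x) * indicator B (G y - F x) \<partial>?M) =
        (\<integral>\<^sup>+x. indicator A (F x + G y) * indicator B (G y - (F x + G y)) \<partial>?M)"
      by (rule shF[where f = "\<lambda>z. indicator A z * indicator B (G y - z)"]) (measurable, rule Gs)
    then show "(\<integral>\<^sup>+x. indicator A (F x) * indicator B (G y - F x) \<partial>?M) =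
        (\<integral>\<^sup>+x. indicator A (F x + G y) * indicator B (- F x) \<partial>?M)" by simp
  qed
  also have "\<dots> = (\<integral>\<^sup>+x. (\<integral>\<^sup>+y. indicator A (F x + G y) * indicator B (- F x) \<partial>?M) \<partial>?M)"
    by (rule P.Fubini') measurable
  also have "\<dots> = (\<integral>\<^sup>+x. emeasure (frame_measure k e') A * indicator B (- F x) \<partial>?M)"
  proof (rule nn_integral_cong)
    fix x
    have "(\<integral>\<^sup>+y. indicator A (F x + G y) * indicator B (- F x) \<partial>?M) =
       (\<integral>\<^sup>+y. indicator A (G y + F x) \<partial>?M) * indicator B (- F x)"
      by (subst nn_integral_multc[symmetric]) (auto simp: add.commute)
    also have "(\<integral>\<^sup>+y. indicator A (G y + F x) \<partial>?M) = (\<integral>\<^sup>+y. indicator A (G y) \<partial>?M)"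
      by (rule shG[symmetric]) (auto simp: Fs)
    finally show "(\<integral>\<^sup>+y. indicator A (F x + G y) * indicator B (- F x) \<partial>?M)
      = emeasure (frame_measure k e') A * indicator B (- F x)"
      unfolding emeasure_frame_measure_nn_integral[OF A] G_def[symmetric] .
  qed
  also have "\<dots> = emeasure (frame_measure k e') A * (\<integral>\<^sup>+x. indicator B (- F x) \<partial>?M)"
    by (rule nn_integral_cmult) measurable
  also have "(\<integral>\<^sup>+x. indicator B (- F x) \<partial>?M) = emeasure (frame_measure k e) (uminus -` B)"
    unfolding emeasure_frame_measure_nn_integral[OF mB] F_def[symmetric]
    by (rule nn_integral_cong) (auto simp: indicator_def)
  finally show ?thesis by (simp add: mult.commute)
qed

text \<open>The right-hand side does not mention \<open>e\<close>: all orthonormal families of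
  \<open>k\<close> vectors give the unit ball the same measure. This fixes the constant in the
  comparison of two families.\<close>

lemma frame_measure_ball:
  assumes "orthonormal_family k e"
  shows "emeasure (frame_measure k e) (ball 0 1) =
    emeasure (Pi\<^sub>M {..<k} (\<lambda>_. lborel)) {x \<in> {..<k} \<rightarrow>\<^sub>E UNIV. sqrt (\<Sum>j<k. (x j)\<^sup>2) < 1}"
  by (subst emeasure_frame_measure) (auto simp: orthonormal_family_norm[OF assms])

text \<open>In coordinates the ball lies between two cubes. Both bounds are wanted in order to
  cancel this measure in \<open>ennreal\<close>.\<close>

lemma frame_measure_ball_bounds:
  assumes e: "orthonormal_family k e"
  shows "0 < emeasure (frame_measure k e) (ball 0 1)" "emeasure (frame_measure k e) (ball 0 1) < \<infinity>"
proof -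
  let ?M = "Pi\<^sub>M {..<k} (\<lambda>_. lborel :: real measure)"
  let ?S = "{x \<in> {..<k} \<rightarrow>\<^sub>E UNIV. sqrt (\<Sum>j<k. (x j)\<^sup>2) < 1}"
  have "?S \<subseteq> Pi\<^sub>E {..<k} (\<lambda>_. {-1..1})"
  proof
    fix x assume x: "x \<in> ?S"
    have "x i \<in> {-1..1}" if "i < k" for i
    proof -
      have "(x i)\<^sup>2 \<le> (\<Sum>j<k. (x j)\<^sup>2)" using that by (intro member_le_sum) auto
      also have "\<dots> < 1" using x by simp
      finally show ?thesis using abs_square_le_1[of "x i"] by (auto simp: abs_le_iff)
    qed
    then show "x \<in> Pi\<^sub>E {..<k} (\<lambda>_. {-1..1})" using x by (auto simp: PiE_iff)
  qed
  then have "emeasure ?M ?S \<le> emeasure ?M (Pi\<^sub>E {..<k} (\<lambda>_. {-1..1}))"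
    by (intro emeasure_mono) (auto intro!: sets_PiM_I_finite)
  also have "\<dots> < \<infinity>"
    by (subst lborel_product.emeasure_PiM) (auto simp: power_less_top_ennreal)
  finally show "emeasure (frame_measure k e) (ball 0 1) < \<infinity>" unfolding frame_measure_ball[OF e] .
  \<comment> \<open>Since \<open>d \<le> 1\<close>, coordinates bounded by \<open>d\<close> have
    squares at most \<open>d\<close>, and \<open>k\<close> of these add up to less than 1. The
    summand 1 in the denominator also covers \<open>k = 0\<close>.\<close>
  define d where "d = 1 / (real k + 1)"
  have d: "0 < d" "d \<le> 1" "real k * d < 1" unfolding d_def by (auto simp: field_simps)
  have "Pi\<^sub>E {..<k} (\<lambda>_. {-d..d}) \<subseteq> ?S"
  proof
    fix x assume x: "x \<in> Pi\<^sub>E {..<k} (\<lambda>_. {-d..d})"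
    have "(x i)\<^sup>2 \<le> d" if "i < k" for i
    proof -
      have "\<bar>x i\<bar> \<le> d" using x that by (force simp: PiE_iff abs_le_iff)
      then have "\<bar>x i\<bar> * \<bar>x i\<bar> \<le> d * 1" using d by (intro mult_mono) auto
      then show ?thesis by (simp add: power2_eq_square)
    qed
    then have "(\<Sum>j<k. (x j)\<^sup>2) \<le> real (card {..<k}) * d" by (intro sum_bounded_above) auto
    also have "\<dots> < 1" using d by simp
    finally show "x \<in> ?S" using x by (auto simp: PiE_iff)
  qed
  moreover have "?S \<in> sets ?M"
  proof -
    have "{x \<in> space ?M. sqrt (\<Sum>j<k. (x j)\<^sup>2) < 1} \<in> sets ?M" by measurable
    then show ?thesis by (simp add: space_PiM)
  qed
  ultimately have "emeasure ?M (Pi\<^sub>E {..<k} (\<lambda>_. {-d..d})) \<le> emeasure ?M ?S"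
    by (rule emeasure_mono)
  moreover have "emeasure ?M (Pi\<^sub>E {..<k} (\<lambda>_. {-d..d})) > 0"
  proof -
    have "emeasure ?M (Pi\<^sub>E {..<k} (\<lambda>_. {-d..d})) = (\<Prod>i<k. ennreal (2 * d))"
      using d by (subst lborel_product.emeasure_PiM) auto
    also have "\<dots> = ennreal ((2 * d) ^ k)" using d by (simp add: ennreal_power)
    also have "\<dots> > 0" using d by simp
    finally show ?thesis .
  qed
  ultimately show "0 < emeasure (frame_measure k e) (ball 0 1)" unfolding frame_measure_ball[OF e] by simp
qed

text \<open>Take the unit ball for \<open>B\<close> in the exchange identity: it is symmetric under
  reflection and has the same measure for both families, and that measure cancels.\<close>

lemma frame_measure_unique:
  fixes e e' :: "nat \<Rightarrow> 'a::euclidean_space"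
  assumes e: "orthonormal_family k e" "orthonormal_family k e'"
    and sp: "span (e ` {..<k}) = span (e' ` {..<k})"
  shows "frame_measure k e = frame_measure k e'"
proof (rule measure_eqI)
  fix A assume "A \<in> sets (frame_measure k e)"
  then have A: "A \<in> sets borel" by simp
  let ?B = "ball 0 1 :: 'a set"
  have [simp]: "uminus -` ?B = ?B" by auto
  have eq: "emeasure (frame_measure k e) ?B = emeasure (frame_measure k e') ?B"
    using e by (simp add: frame_measure_ball)
  have "emeasure (frame_measure k e) A * emeasure (frame_measure k e') ?B =
         emeasure (frame_measure k e') ?B * emeasure (frame_measure k e') A"
    using frame_measure_exchange[OF e sp A, of ?B] eq by simp
  then show "emeasure (frame_measure k e) A = emeasure (frame_measure k e') A"
    using frame_measure_ball_bounds[OF e(2)]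
    by (metis ennreal_mult_cancel_left mult.commute less_irrefl infinity_ennreal_def)
qed simp

section \<open>From linear families to frames of an affine flat\<close>

lemma orthonormal_frame_iff:
  "orthonormal_frame k T p e \<longleftrightarrow> orthonormal_family k e \<and> T = (\<lambda>w. p + w) ` span (e ` {..<k})"
  by (simp add: orthonormal_frame_def orthonormal_family_def)

text \<open>Coordinates are a Borel isomorphism between the product space and the span.
  Measurability of a coordinate set is therefore a property of the set alone, not of the
  family.\<close>

lemma frame_coordinates_sets_iff:
  assumes e: "orthonormal_family k e"
  shows "{x \<in> {..<k} \<rightarrow>\<^sub>E UNIV. (\<Sum>i<k. x i *\<^sub>R e i) \<in> A} \<in> sets (Pi\<^sub>M {..<k} (\<lambda>_. lborel)) \<longleftrightarrow>
    A \<inter> span (e ` {..<k}) \<in> sets borel" (is "?X \<in> sets ?M \<longleftrightarrow> _")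
proof
  assume X: "?X \<in> sets ?M"
  let ?C = "\<lambda>z. \<lambda>i\<in>{..<k}. z \<bullet> e i"
  have m: "?C \<in> measurable borel ?M" by measurable
  have "?C -` ?X \<inter> span (e ` {..<k}) \<in> sets borel"
    using measurable_sets[OF m X] by (intro sets.Int) (auto intro!: borel_closed closed_span)
  also have "?C -` ?X \<inter> span (e ` {..<k}) = A \<inter> span (e ` {..<k})"
    using orthonormal_family_expand[OF e] by (auto simp: PiE_iff)
  finally show "A \<inter> span (e ` {..<k}) \<in> sets borel" .
next
  assume A: "A \<inter> span (e ` {..<k}) \<in> sets borel"
  have m: "(\<lambda>x. \<Sum>i<k. x i *\<^sub>R e i) \<in> measurable ?M borel" by measurable
  have "?X = (\<lambda>x. \<Sum>i<k. x i *\<^sub>R e i) -` (A \<inter> span (e ` {..<k})) \<inter> space ?M"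
    by (auto simp: space_PiM frame_sum_span)
  then show "?X \<in> sets ?M" using measurable_sets[OF m A] by simp
qed

lemma emeasure_frame_coordinates_unique:
  fixes e e' :: "nat \<Rightarrow> 'a::euclidean_space"
  assumes e: "orthonormal_family k e" "orthonormal_family k e'"
    and sp: "span (e ` {..<k}) = span (e' ` {..<k})"
  shows "emeasure (Pi\<^sub>M {..<k} (\<lambda>_. lborel)) {x \<in> {..<k} \<rightarrow>\<^sub>E UNIV. (\<Sum>i<k. x i *\<^sub>R e i) \<in> A} =
    emeasure (Pi\<^sub>M {..<k} (\<lambda>_. lborel)) {x \<in> {..<k} \<rightarrow>\<^sub>E UNIV. (\<Sum>i<k. x i *\<^sub>R e' i) \<in> A}"
proof (cases "A \<inter> span (e ` {..<k}) \<in> sets borel")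
  case True
  have *: "{x \<in> {..<k} \<rightarrow>\<^sub>E UNIV. (\<Sum>i<k. x i *\<^sub>R e i) \<in> A} =
     {x \<in> {..<k} \<rightarrow>\<^sub>E UNIV. (\<Sum>i<k. x i *\<^sub>R e i) \<in> A \<inter> span (e ` {..<k})}"
     for e :: "nat \<Rightarrow> 'a"
    by (auto simp: frame_sum_span)
  show ?thesis
    unfolding *[of e] *[of e'] sp[symmetric]
    using True frame_measure_unique[OF e sp] by (simp only: emeasure_frame_measure[symmetric])
next
  \<comment> \<open>Neither coordinate set is measurable, so both sides are 0 by the default value
    of \<open>emeasure\<close>.\<close>
  case False
  then show ?thesis
    using frame_coordinates_sets_iff[OF e(1), of A] frame_coordinates_sets_iff[OF e(2), of A]
    unfolding sp by (simp add: emeasure_notin_sets)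
qed

lemma orthonormal_frame_origin:
  assumes "orthonormal_frame k T p e"
  shows "p \<in> T"
  using assms span_zero[of "e ` {..<k}"] by (force simp: orthonormal_frame_def)

text \<open>Recovers the direction space from \<open>T\<close> by subtracting any of its points; two
  frames of one flat thus span the same subspace.\<close>

lemma orthonormal_frame_span:
  assumes "orthonormal_frame k T p e" "q \<in> T"
  shows "span (e ` {..<k}) = (\<lambda>x. x - q) ` T"
proof -
  obtain w where w: "q = p + w" "w \<in> span (e ` {..<k})" using assms by (auto simp: orthonormal_frame_def)
  have T: "T = (\<lambda>w. p + w) ` span (e ` {..<k})" using assms by (simp add: orthonormal_frame_def)
  show ?thesis
  proof (intro subset_antisym subsetI)
    fix z assume z: "z \<in> span (e ` {..<k})"
    then have "p + (z + w) \<in> T" unfolding T using w by (intro imageI span_add)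
    moreover have "z = (p + (z + w)) - q" using w by simp
    ultimately show "z \<in> (\<lambda>x. x - q) ` T" by (rule rev_image_eqI)
  next
    fix z assume "z \<in> (\<lambda>x. x - q) ` T"
    then obtain w' where "w' \<in> span (e ` {..<k})" "z = w' - w" unfolding T using w by auto
    then show "z \<in> span (e ` {..<k})" using w by (simp add: span_diff)
  qed
qed

text \<open>Two frames of \<open>T\<close> differ by a shift of the origin along the direction space
  and by a change of orthonormal basis of that space. Neither affects the measure, so the definite
  description may be evaluated in any frame.\<close>

lemma flat_volume_eq:
  fixes e :: "nat \<Rightarrow> 'a::euclidean_space"
  assumes fr: "orthonormal_frame k T p e"
  shows "flat_volume k T A = emeasure (Pi\<^sub>M {..<k} (\<lambda>_. lborel))
           {x \<in> {..<k} \<rightarrow>\<^sub>E UNIV. p + (\<Sum>i<k. x i *\<^sub>R e i) \<in> A}"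
  unfolding flat_volume_def
proof (rule the_equality)
  let ?M = "Pi\<^sub>M {..<k} (\<lambda>_. lborel :: real measure)"
  let ?m = "\<lambda>p e. emeasure ?M {x \<in> {..<k} \<rightarrow>\<^sub>E UNIV. p + (\<Sum>i<k. x i *\<^sub>R e i) \<in> A}"
  show "\<exists>p' e'. orthonormal_frame k T p' e' \<and> ?m p e = ?m p' e'" using fr by blast
  fix m assume "\<exists>p e. orthonormal_frame k T p e \<and> m = ?m p e"
  then obtain p' e' where fr': "orthonormal_frame k T p' e'" and m: "m = ?m p' e'" by blast
  let ?S = "span (e ` {..<k})"
  have e: "orthonormal_family k e" "orthonormal_family k e'" using fr fr' by (auto simp: orthonormal_frame_iff)
  have sp: "?S = span (e' ` {..<k})"
    using orthonormal_frame_span[OF fr] orthonormal_frame_span[OF fr'] orthonormal_frame_origin[OF fr] by simp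
  define w where "w = p' - p"
  have w: "w \<in> ?S"
    using orthonormal_frame_span[OF fr orthonormal_frame_origin[OF fr]] orthonormal_frame_origin[OF fr']
    unfolding w_def by simp
  have p': "p' = p + w" by (simp add: w_def)
  let ?A = "{z. p + z \<in> A}" and ?A' = "{z. p + w + z \<in> A}"
  have tr: "(\<lambda>z. z + w) -` (?A \<inter> ?S) = ?A' \<inter> ?S"
    using w by (auto simp: add_ac span_add_eq2)
  have tr': "(\<lambda>z. z - w) -` (?A' \<inter> ?S) = ?A \<inter> ?S"
  proof -
    have "z - w \<in> ?S \<longleftrightarrow> z \<in> ?S" for z
      using span_add[OF _ w, of "z - w"] span_diff[OF _ w, of z] by auto
    then show ?thesis by (simp add: vimage_def Int_def)
  qed
  have iff: "?A \<inter> ?S \<in> sets borel \<longleftrightarrow> ?A' \<inter> ?S \<in> sets borel"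
  proof
    assume "?A \<inter> ?S \<in> sets borel"
    moreover have "(\<lambda>z. z + w) \<in> borel_measurable borel" by measurable
    ultimately show "?A' \<inter> ?S \<in> sets borel"
      using measurable_sets[of "\<lambda>z. z + w" borel borel "?A \<inter> ?S"] unfolding tr by simp
  next
    assume "?A' \<inter> ?S \<in> sets borel"
    moreover have "(\<lambda>z. z - w) \<in> borel_measurable borel" by measurable
    ultimately show "?A \<inter> ?S \<in> sets borel"
      using measurable_sets[of "\<lambda>z. z - w" borel borel "?A' \<inter> ?S"] unfolding tr' by simp
  qed
  have restr: "{x \<in> {..<k} \<rightarrow>\<^sub>E UNIV. (\<Sum>i<k. x i *\<^sub>R e i) \<in> B} =
     {x \<in> {..<k} \<rightarrow>\<^sub>E UNIV. (\<Sum>i<k. x i *\<^sub>R e i) \<in> B \<inter> ?S}" for B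
    by (auto simp: frame_sum_span)
  have "m = emeasure ?M {x \<in> {..<k} \<rightarrow>\<^sub>E UNIV. (\<Sum>i<k. x i *\<^sub>R e' i) \<in> ?A'}"
    unfolding m p' by simp
  also have "\<dots> = emeasure ?M {x \<in> {..<k} \<rightarrow>\<^sub>E UNIV. (\<Sum>i<k. x i *\<^sub>R e i) \<in> ?A'}"
    by (rule emeasure_frame_coordinates_unique[symmetric, OF e sp])
  also have "\<dots> = emeasure ?M {x \<in> {..<k} \<rightarrow>\<^sub>E UNIV. (\<Sum>i<k. x i *\<^sub>R e i) \<in> ?A}"
  proof (cases "?A \<inter> ?S \<in> sets borel")
    case True
    then have A: "?A \<inter> ?S \<in> sets borel" "?A' \<inter> ?S \<in> sets borel" using iff by auto
    have "emeasure (frame_measure k e) (?A \<inter> ?S) = emeasure (frame_measure k e) (?A' \<inter> ?S)"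
      unfolding emeasure_frame_measure_nn_integral[OF A(1)] emeasure_frame_measure_nn_integral[OF A(2)]
      using nn_integral_frame_translate[OF e(1) w, of "indicator (?A \<inter> ?S)"] A(1)
      unfolding tr[symmetric] by (auto simp: indicator_def)
    then show ?thesis
      unfolding emeasure_frame_measure[OF A(1)] emeasure_frame_measure[OF A(2)] restr[symmetric] by simp
  next
    \<comment> \<open>A shift along the span preserves being Borel in both directions, so again both
      sides take the default value 0.\<close>
    case False
    then show ?thesis
      using iff frame_coordinates_sets_iff[OF e(1), of ?A] frame_coordinates_sets_iff[OF e(1), of ?A']
      by (simp add: emeasure_notin_sets)
  qed
  also have "\<dots> = ?m p e" by simp
  finally show "m = ?m p e" .
qed

section \<open>Facets of a simplex\<close>

lemma rel_interior_subset_affine_hull: "rel_interior s \<subseteq> affine hull s"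
  using rel_interior_subset[of s] hull_subset[of s affine] by (rule subset_trans)

lemma tangent_space_diff: "x \<in> s \<Longrightarrow> y \<in> s \<Longrightarrow> x - y \<in> tangent_space s"
  unfolding tangent_space_def by (rule span_base) blast

lemma subspace_tangent_space: "subspace (tangent_space s)"
  by (simp add: tangent_space_def)

lemma tangent_space_eq_span: "q \<in> s \<Longrightarrow> tangent_space s = span ((\<lambda>x. x - q) ` s)"
  unfolding tangent_space_def span_eq
proof safe
  fix x y assume *: "q \<in> s" "x \<in> s" "y \<in> s"
  have "(x - q) - (y - q) \<in> span ((\<lambda>x. x - q) ` s)"
    using * by (intro span_diff span_base) auto
  then show "x - y \<in> span ((\<lambda>x. x - q) ` s)" by simp
next
  fix x assume "q \<in> s" "x \<in> s"
  then show "x - q \<in> span {x - y |x y. x \<in> s \<and> y \<in> s}" by (intro span_base) blast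
qed

lemma affine_hull_eq_tangent_space:
  assumes "p \<in> affine hull s"
  shows "affine hull s = (\<lambda>w. p + w) ` tangent_space s"
proof -
  obtain q where q: "q \<in> s" using assms by force
  have *: "affine hull s = (\<lambda>w. q + w) ` tangent_space s"
    using affine_hull_span_gen[of q s] q
    by (simp add: tangent_space_eq_span[OF q] hull_inc)
  then obtain w where w: "w \<in> tangent_space s" "p = q + w" using assms by auto
  show ?thesis
  proof (intro subset_antisym subsetI)
    fix x assume "x \<in> affine hull s"
    then obtain w' where w': "w' \<in> tangent_space s" "x = q + w'" using * by auto
    then have "x = p + (w' - w)" using w by simp
    then show "x \<in> (\<lambda>w. p + w) ` tangent_space s"
      using w w' subspace_diff[OF subspace_tangent_space] by blast
  next
    fix x assume "x \<in> (\<lambda>w. p + w) ` tangent_space s"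
    then obtain w' where w': "w' \<in> tangent_space s" "x = p + w'" by auto
    then have "x = q + (w + w')" using w by simp
    then show "x \<in> affine hull s"
      using w w' subspace_add[OF subspace_tangent_space] * by blast
  qed
qed

lemma affine_hull_diff_tangent_space:
  assumes "p \<in> affine hull s"
  shows "x \<in> affine hull s \<longleftrightarrow> x - p \<in> tangent_space s"
  unfolding affine_hull_eq_tangent_space[OF assms] by (force simp: image_iff)

lemma tangent_space_mono: "s \<subseteq> t \<Longrightarrow> tangent_space s \<subseteq> tangent_space t"
  unfolding tangent_space_def by (rule span_mono) blast

lemma simplex_nonempty: "int n simplex s \<Longrightarrow> s \<noteq> {}"
  by auto

text \<open>Exhibits the apex \<open>c\<close> opposite to the facet; every point of
  \<open>s\<close> is then a convex combination of \<open>c\<close> and a point of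
  \<open>h\<close>.\<close>

lemma simplex_facet_insert:
  fixes s h :: "'a::euclidean_space set"
  assumes n: "n \<ge> 1" and s: "int n simplex s" and h: "int (n - 1) simplex h" and f: "h face_of s"
  obtains C c where "C \<noteq> {}" "c \<notin> affine hull C" "h = convex hull C" "s = convex hull (insert c C)"
proof -
  obtain D where D: "\<not> affine_dependent D" "int (card D) = int n + 1" "s = convex hull D"
    using s by (auto simp: simplex_def)
  obtain C where C: "C \<subseteq> D" "h = convex hull C"
    using f D face_of_convex_hull_affine_independent by metis
  have indC: "\<not> affine_dependent C" using D C affine_independent_subset by blast
  have "aff_dim h = int (card C) - 1"
    using aff_dim_affine_independent[OF indC] by (simp add: C(2) aff_dim_convex_hull)
  then have cC: "card C = n" using aff_dim_simplex[OF h] n by simp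
  have fD: "finite D" using D(1) by (rule aff_independent_finite)
  then have "card (D - C) = 1" using D(2) C(1) cC by (simp add: card_Diff_subset finite_subset)
  then obtain c where c: "D - C = {c}" by (rule card_1_singletonE)
  have "D = insert c C" "D - {c} = C" using c C by auto
  moreover have "c \<notin> affine hull (D - {c})" using D(1) c by (auto simp: affine_dependent_def)
  moreover have "C \<noteq> {}" using cC n by auto
  ultimately show ?thesis using that C D by metis
qed

text \<open>A form of the inner unit normal that is free of choice. The fourth conjunct makes
  \<open>h\<close> of codimension one in \<open>s\<close>, the last one puts \<open>s\<close> on the
  positive side of \<open>h\<close> and touching height zero only in \<open>h\<close>.\<close>

definition facet_normal :: "'a::euclidean_space set \<Rightarrow> 'a set \<Rightarrow> 'a \<Rightarrow> bool" where
  "facet_normal h s u \<longleftrightarrow> norm u = 1 \<and> u \<in> tangent_space s \<and> (\<forall>w \<in> tangent_space h. u \<bullet> w = 0) \<and>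
     (\<forall>w \<in> tangent_space s. w - (w \<bullet> u) *\<^sub>R u \<in> tangent_space h) \<and>
     (\<forall>p \<in> affine hull h. \<forall>x \<in> s. (x - p) \<bullet> u \<ge> 0 \<and> ((x - p) \<bullet> u = 0 \<longrightarrow> x \<in> h))"

text \<open>The normal is the component \<open>z\<close> of \<open>c - p\<close> orthogonal to
  \<open>h\<close>, normalised; \<open>z\<close> is non-zero because the apex is not in the affine
  hull of \<open>h\<close>.\<close>

lemma facet_normal_exists:
  fixes s h :: "'a::euclidean_space set"
  assumes n: "n \<ge> 1" and s: "int n simplex s" and h: "int (n - 1) simplex h" and f: "h face_of s"
  obtains u where "facet_normal h s u"
proof -
  obtain C c where C: "C \<noteq> {}" "c \<notin> affine hull C" "h = convex hull C" "s = convex hull (insert c C)"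
    using simplex_facet_insert[OF assms] by blast
  obtain p where p: "p \<in> h" using C(1) hull_subset[of C convex] unfolding C(3) by blast
  then have ph: "p \<in> affine hull h" by (rule hull_inc)
  let ?T = "tangent_space h"
  obtain y z where y: "y \<in> span ?T" and z: "\<And>w. w \<in> span ?T \<Longrightarrow> orthogonal z w" and yz: "c - p = y + z"
    using orthogonal_subspace_decomp_exists[of ?T "c - p"] by blast
  have spT: "span ?T = ?T" by (simp add: tangent_space_def)
  have "z \<noteq> 0"
  proof
    assume "z = 0"
    then have "c \<in> affine hull h" using affine_hull_diff_tangent_space[OF ph] y yz spT by simp
    then show False using C by (simp add: affine_hull_convex_hull)
  qed
  define u where "u = z /\<^sub>R norm z"
  have nu: "norm u = 1" using \<open>z \<noteq> 0\<close> by (simp add: u_def)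
  have zu: "z = norm z *\<^sub>R u" using \<open>z \<noteq> 0\<close> by (simp add: u_def)
  have uu: "u \<bullet> u = 1" using nu by (simp add: norm_eq_1)
  have uT: "u \<bullet> w = 0" if "w \<in> ?T" for w
    using z[of w] that spT by (simp add: u_def orthogonal_def)
  have Tu: "w \<bullet> u = 0" if "w \<in> ?T" for w
    using uT[OF that] by (simp add: inner_commute)
  have hs: "?T \<subseteq> tangent_space s" using f by (intro tangent_space_mono face_of_imp_subset)
  have cs: "c \<in> s" using C by (simp add: hull_inc)
  have ps: "p \<in> s" using p f face_of_imp_subset by blast
  have zs: "z \<in> tangent_space s"
  proof -
    have "(c - p) - y \<in> tangent_space s"
      by (rule subspace_diff[OF subspace_tangent_space]) (use tangent_space_diff[OF cs ps] y hs spT in auto)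
    then show ?thesis using yz by simp
  qed
  \<comment> \<open>\<open>\<mu>\<close> is the barycentric coordinate of the apex. The height of
    \<open>x\<close> over \<open>h\<close> is \<open>\<mu> * norm z\<close>, so it is non-negative
    and vanishes only for \<open>x\<close> in \<open>h\<close>.\<close>
  have dec: "\<exists>\<mu>\<ge>0. \<exists>b \<in> h. (\<mu> = 0 \<longrightarrow> x = b) \<and> x - p = (1 - \<mu>) *\<^sub>R (b - p) + \<mu> *\<^sub>R y + (\<mu> * norm z) *\<^sub>R u"
    if x: "x \<in> s" for x
  proof -
    obtain \<mu> v b where *: "\<mu> \<ge> 0" "v \<ge> 0" "\<mu> + v = 1" "b \<in> h" "x = \<mu> *\<^sub>R c + v *\<^sub>R b"
      using x C unfolding C(4) convex_hull_insert[OF C(1)] by blast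
    have v: "v = 1 - \<mu>" using * by simp
    have "x - p = (1 - \<mu>) *\<^sub>R (b - p) + \<mu> *\<^sub>R (c - p)" unfolding *(5) v by (simp add: algebra_simps)
    also have "\<mu> *\<^sub>R (c - p) = \<mu> *\<^sub>R y + (\<mu> * norm z) *\<^sub>R u"
      unfolding yz scaleR_add_right by (subst zu) simp
    finally show ?thesis using * v by (intro exI[of _ \<mu>] conjI bexI[of _ b]) (auto simp: add.assoc)
  qed
  have "facet_normal h s u" unfolding facet_normal_def
  proof (intro conjI ballI)
    show "norm u = 1" by (rule nu)
    show "u \<in> tangent_space s" unfolding u_def by (intro subspace_scale subspace_tangent_space zs)
    show "u \<bullet> w = 0" if "w \<in> ?T" for w using uT that .
  next
    fix w assume "w \<in> tangent_space s"
    then have "w \<in> span ((\<lambda>x. x - p) ` s)" using tangent_space_eq_span[OF ps] by simp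
    moreover have "subspace {w. w - (w \<bullet> u) *\<^sub>R u \<in> ?T}"
      unfolding subspace_def
    proof (intro conjI ballI allI)
      fix a b assume *: "a \<in> {w. w - (w \<bullet> u) *\<^sub>R u \<in> ?T}" "b \<in> {w. w - (w \<bullet> u) *\<^sub>R u \<in> ?T}"
      have "(a + b) - ((a + b) \<bullet> u) *\<^sub>R u = (a - (a \<bullet> u) *\<^sub>R u) + (b - (b \<bullet> u) *\<^sub>R u)"
        by (simp add: algebra_simps)
      then show "a + b \<in> {w. w - (w \<bullet> u) *\<^sub>R u \<in> ?T}"
        using * subspace_add[OF subspace_tangent_space, of "a - (a \<bullet> u) *\<^sub>R u" h] by (metis mem_Collect_eq)
    next
      fix r a assume *: "a \<in> {w. w - (w \<bullet> u) *\<^sub>R u \<in> ?T}"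
      have "r *\<^sub>R a - ((r *\<^sub>R a) \<bullet> u) *\<^sub>R u = r *\<^sub>R (a - (a \<bullet> u) *\<^sub>R u)"
        by (simp add: algebra_simps)
      then show "r *\<^sub>R a \<in> {w. w - (w \<bullet> u) *\<^sub>R u \<in> ?T}"
        using * subspace_scale[OF subspace_tangent_space, of "a - (a \<bullet> u) *\<^sub>R u" h] by simp
    qed (simp add: subspace_0[OF subspace_tangent_space])
    moreover have "x - p - ((x - p) \<bullet> u) *\<^sub>R u \<in> ?T" if "x \<in> s" for x
    proof -
      obtain \<mu> b where *: "b \<in> h" "x - p = (1 - \<mu>) *\<^sub>R (b - p) + \<mu> *\<^sub>R y + (\<mu> * norm z) *\<^sub>R u"
        using dec[OF \<open>x \<in> s\<close>] by blast
      have "(x - p) \<bullet> u = \<mu> * norm z"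
        using Tu[OF tangent_space_diff[OF \<open>b \<in> h\<close> p]] Tu[of y] y spT uu
        unfolding * inner_add_left by simp
      then have "x - p - ((x - p) \<bullet> u) *\<^sub>R u = (1 - \<mu>) *\<^sub>R (b - p) + \<mu> *\<^sub>R y"
        unfolding *(2) by simp
      also have "\<dots> \<in> ?T"
        using tangent_space_diff[OF \<open>b \<in> h\<close> p] y spT
        by (intro subspace_add subspace_scale subspace_tangent_space) auto
      finally show ?thesis .
    qed
    ultimately show "w - (w \<bullet> u) *\<^sub>R u \<in> ?T"
      using span_induct[of w "(\<lambda>x. x - p) ` s" "\<lambda>w. w - (w \<bullet> u) *\<^sub>R u \<in> ?T"] by blast
  next
    fix q x assume q: "q \<in> affine hull h" and x: "x \<in> s"
    obtain \<mu> b where *: "\<mu> \<ge> 0" "\<mu> = 0 \<longrightarrow> x = b" "b \<in> h" "x - p = (1 - \<mu>) *\<^sub>R (b - p) + \<mu> *\<^sub>R y + (\<mu> * norm z) *\<^sub>R u"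
        using dec[OF \<open>x \<in> s\<close>] by blast
    have "(x - p) \<bullet> u = \<mu> * norm z"
        using Tu[OF tangent_space_diff[OF \<open>b \<in> h\<close> p]] Tu[of y] y spT uu
        unfolding * inner_add_left by simp
    moreover have "(q - p) \<bullet> u = 0"
      using Tu[of "q - p"] q affine_hull_diff_tangent_space[OF ph] by simp
    ultimately have "(x - q) \<bullet> u = \<mu> * norm z"
      by (simp add: inner_diff_left)
    then show "0 \<le> (x - q) \<bullet> u" "(x - q) \<bullet> u = 0 \<longrightarrow> x \<in> h"
      using * \<open>z \<noteq> 0\<close> by auto
  qed
  then show ?thesis by (rule that)
qed

section \<open>The inner normal of a facet\<close>

locale simplex_facet =
  fixes n :: nat and h s :: "'a::euclidean_space set"
  assumes n_pos: "n \<ge> 1" and s_simplex: "int n simplex s" and h_simplex: "int (n - 1) simplex h"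
    and h_face: "h face_of s"
begin

lemma h_subset: "h \<subseteq> s"
  using h_face by (rule face_of_imp_subset)

lemma h_neq: "h \<noteq> s"
  using aff_dim_simplex[OF s_simplex] aff_dim_simplex[OF h_simplex] n_pos by auto

lemma rel_interior_disjoint: "h \<inter> rel_interior s = {}"
  using face_of_disjoint_rel_interior[OF h_face h_neq] .

lemma facet_normal_pos:
  assumes "facet_normal h s u" "p \<in> affine hull h" "x \<in> rel_interior s"
  shows "(x - p) \<bullet> u > 0"
  using assms rel_interior_disjoint rel_interior_subset[of s]
  unfolding facet_normal_def by (metis disjoint_iff less_eq_real_def subsetD)

lemma facet_normal_affine:
  assumes u: "facet_normal h s u" and p: "p \<in> affine hull h" and x: "x \<in> affine hull s" "(x - p) \<bullet> u = 0"
  shows "x \<in> affine hull h"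
proof -
  have "p \<in> affine hull s" using p hull_mono[OF h_subset] by blast
  then have "x - p \<in> tangent_space s" using x affine_hull_diff_tangent_space by blast
  then have "x - p \<in> tangent_space h" using u x by (force simp: facet_normal_def)
  then show ?thesis using affine_hull_diff_tangent_space[OF p] by blast
qed

text \<open>The point \<open>q + r *\<^sub>R u\<close> lies on the segment from an interior point
  \<open>m\<close> of \<open>s\<close> to a point of \<open>h\<close> close to \<open>q\<close>, and
  all of such a segment except its end in \<open>h\<close> is in the relative interior.\<close>

lemma facet_normal_enters:
  assumes u: "facet_normal h s u" and q: "q \<in> rel_interior h"
  shows "\<exists>\<delta>>0. \<forall>r. 0 < r \<and> r < \<delta> \<longrightarrow> q + r *\<^sub>R u \<in> rel_interior s"
proof -
  have uu: "u \<bullet> u = 1" and us: "u \<in> tangent_space s" using u unfolding facet_normal_def by (simp_all add: norm_eq_1)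
  have qh: "q \<in> affine hull h" using q rel_interior_subset_affine_hull by blast
  have qs: "q \<in> affine hull s" using qh hull_mono[OF h_subset] by blast
  obtain m where m: "m \<in> rel_interior s"
    using rel_interior_eq_empty[of s] convex_simplex[OF s_simplex] simplex_nonempty[OF s_simplex] by blast
  define H where "H = (m - q) \<bullet> u"
  have H: "H > 0" unfolding H_def using facet_normal_pos[OF u qh m] .
  obtain \<epsilon> where \<epsilon>: "\<epsilon> > 0" "ball q \<epsilon> \<inter> affine hull h \<subseteq> h" using q by (auto simp: mem_rel_interior_ball)
  \<comment> \<open>The line from \<open>m\<close> through \<open>q + r *\<^sub>R u\<close> meets
    the plane of \<open>h\<close> in \<open>q' r\<close>. The weight of \<open>m\<close> has to be
    \<open>r / H\<close>, since \<open>m\<close> has height \<open>H\<close> and the target point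
    has height \<open>r\<close>.\<close>
  define q' where "q' r = (1 / (1 - r / H)) *\<^sub>R (q + r *\<^sub>R u - (r / H) *\<^sub>R m)" for r
  have "(q' \<longlongrightarrow> (1 / (1 - 0 / H)) *\<^sub>R (q + 0 *\<^sub>R u - (0 / H) *\<^sub>R m)) (at_right 0)"
    unfolding q'_def using H by (intro tendsto_intros) auto
  then have "(q' \<longlongrightarrow> q) (at_right 0)" by simp
  then have "eventually (\<lambda>r. dist (q' r) q < \<epsilon>) (at_right 0)" using \<epsilon>(1) by (rule tendstoD)
  then obtain d where d: "d > 0" "\<And>r. 0 < r \<Longrightarrow> r < d \<Longrightarrow> dist (q' r) q < \<epsilon>"
    by (auto simp: eventually_at_right[OF zero_less_one])
  have "q + r *\<^sub>R u \<in> rel_interior s" if r: "0 < r" "r < min d H" for r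
  proof -
    define \<tau> where "\<tau> = r / H"
    have \<tau>: "0 < \<tau>" "\<tau> < 1" using r H by (auto simp: \<tau>_def)
    have eq: "(1 - \<tau>) *\<^sub>R q' r = q + r *\<^sub>R u - \<tau> *\<^sub>R m" unfolding q'_def \<tau>_def[symmetric] using \<tau> by simp
    have q'q: "q' r - q = (1 / (1 - \<tau>)) *\<^sub>R (r *\<^sub>R u - \<tau> *\<^sub>R (m - q))"
    proof -
      have "(1 - \<tau>) *\<^sub>R (q' r - q) = r *\<^sub>R u - \<tau> *\<^sub>R (m - q)"
        unfolding scaleR_diff_right eq by (simp add: algebra_simps)
      moreover have "q' r - q = (1 / (1 - \<tau>)) *\<^sub>R ((1 - \<tau>) *\<^sub>R (q' r - q))" using \<tau> by simp
      ultimately show ?thesis by (simp only:)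
    qed
    have "m - q \<in> tangent_space s"
      using affine_hull_diff_tangent_space[OF qs] m rel_interior_subset_affine_hull by blast
    then have "q' r - q \<in> tangent_space s"
      unfolding q'q using us
      by (intro subspace_scale[OF subspace_tangent_space] subspace_diff[OF subspace_tangent_space, of "r *\<^sub>R u"])
    then have 1: "q' r \<in> affine hull s" using affine_hull_diff_tangent_space[OF qs] by blast
    have "(r *\<^sub>R u - \<tau> *\<^sub>R (m - q)) \<bullet> u = 0"
      using H by (simp add: inner_diff_left uu H_def[unfolded inner_diff_left, symmetric] \<tau>_def)
    then have "(q' r - q) \<bullet> u = 0" unfolding q'q by simp
    then have "q' r \<in> affine hull h" using facet_normal_affine[OF u qh 1] by blast
    moreover have "q' r \<in> ball q \<epsilon>" using d(2)[of r] r by (simp add: dist_commute)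
    ultimately have "q' r \<in> s" using \<epsilon> h_subset by blast
    then have "q' r - \<tau> *\<^sub>R (q' r - m) \<in> rel_interior s"
      using \<tau> m convex_simplex[OF s_simplex] by (intro rel_interior_convex_shrink) auto
    also have "q' r - \<tau> *\<^sub>R (q' r - m) = (1 - \<tau>) *\<^sub>R q' r + \<tau> *\<^sub>R m" by (simp add: algebra_simps)
    also have "\<dots> = q + r *\<^sub>R u" unfolding eq by simp
    finally show ?thesis .
  qed
  then show ?thesis using d(1) H by (intro exI[of _ "min d H"]) auto
qed

lemma h_rel_interior_nonempty: obtains q where "q \<in> rel_interior h"
  using rel_interior_eq_empty[of h] convex_simplex[OF h_simplex] simplex_nonempty[OF h_simplex] by blast

text \<open>Uniqueness in the definition of \<open>inward\<close>: for another candidate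
  \<open>u'\<close>, the vector \<open>u' - c *\<^sub>R u\<close> is both tangent and orthogonal to
  \<open>h\<close>, hence 0. Unit length leaves two signs, and entering the interior of
  \<open>s\<close> excludes the negative one.\<close>

lemma facet_normal_inward: "facet_normal h s (inward h s)"
proof -
  obtain u where u: "facet_normal h s u"
    using facet_normal_exists[OF n_pos s_simplex h_simplex h_face] by blast
  have "inward h s = u" unfolding inward_def
  proof (rule the_equality)
    obtain q where q: "q \<in> rel_interior h" using h_rel_interior_nonempty by blast
    obtain \<delta> where \<delta>: "\<delta> > 0" "\<And>r. 0 < r \<and> r < \<delta> \<Longrightarrow> q + r *\<^sub>R u \<in> rel_interior s"
      using facet_normal_enters[OF u q] by blast
    have "\<exists>x\<in>rel_interior h. \<exists>r>0. x + r *\<^sub>R u \<in> rel_interior s"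
      using q \<delta> by (intro bexI[of _ q] exI[of _ "\<delta> / 2"]) auto
    then show "norm u = 1 \<and> u \<in> tangent_space s \<and> (\<forall>w\<in>tangent_space h. u \<bullet> w = 0) \<and>
        (\<exists>x\<in>rel_interior h. \<exists>r>0. x + r *\<^sub>R u \<in> rel_interior s)"
      using u by (auto simp: facet_normal_def)
  next
    fix u' assume u': "norm u' = 1 \<and> u' \<in> tangent_space s \<and> (\<forall>w\<in>tangent_space h. u' \<bullet> w = 0) \<and>
        (\<exists>x\<in>rel_interior h. \<exists>r>0. x + r *\<^sub>R u' \<in> rel_interior s)"
    define c where "c = u' \<bullet> u"
    let ?w = "u' - c *\<^sub>R u"
    have w: "?w \<in> tangent_space h" using u u' by (simp add: facet_normal_def c_def)
    have "?w \<bullet> ?w = u' \<bullet> ?w - c * (u \<bullet> ?w)" by (simp add: inner_diff_left)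
    also have "\<dots> = 0" using w u u' by (simp add: facet_normal_def)
    finally have eq: "u' = c *\<^sub>R u" by simp
    have "\<bar>c\<bar> = 1" using u u' unfolding eq by (simp add: facet_normal_def)
    moreover obtain x r where x: "x \<in> rel_interior h" "r > 0" "x + r *\<^sub>R u' \<in> rel_interior s" using u' by blast
    have "x \<in> affine hull h" using x rel_interior_subset_affine_hull by blast
    from facet_normal_pos[OF u this x(3)] have "c > 0" using x(2) by (simp add: c_def zero_less_mult_iff)
    ultimately show "u' = u" using eq by simp
  qed
  then show ?thesis using u by simp
qed

end

section \<open>Rotations and hinge angles\<close>

lemma orthogonal_matrix_inner:
  fixes A :: "real^'m^'m"
  assumes "orthogonal_matrix A"
  shows "(A *v x) \<bullet> (A *v y) = x \<bullet> y"
proof -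
  have "(A *v x) \<bullet> (A *v y) = x \<bullet> (transpose A *v (A *v y))"
    by (metis dot_lmul_matrix inner_commute vector_transpose_matrix)
  also have "\<dots> = x \<bullet> y"
    using assms by (simp add: matrix_vector_mul_assoc orthogonal_matrix)
  finally show ?thesis .
qed

text \<open>Conjugation with an orthogonal matrix that maps an axis to \<open>a\<close> makes
  \<open>Q\<close> diagonal, with one entry -1 and all others 1.\<close>

lemma det_reflection:
  fixes Q :: "real^'m^'m"
  assumes a: "norm a = 1" and Qa: "Q *v a = - a" and Qz: "\<And>z. z \<bullet> a = 0 \<Longrightarrow> Q *v z = z"
  shows "det Q = - 1"
proof -
  \<comment> \<open>Any coordinate axis serves, so an arbitrary index is named.\<close>
  define k :: 'm where "k = undefined"
  obtain A where A: "orthogonal_matrix A" "A *v (axis k 1) = a"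
    using orthogonal_matrix_exists_basis[OF a, of k] by blast
  let ?B = "transpose A ** Q ** A"
  have tA: "transpose A ** A = mat 1" using A by (simp add: orthogonal_matrix)
  have tAx: "transpose A *v (A *v x) = x" for x
    by (simp add: matrix_vector_mul_assoc tA)
  have col: "column j ?B = (if j = k then - axis j 1 else axis j 1)" for j
  proof -
    have "column j ?B = transpose A *v (Q *v (A *v axis j 1))"
      by (simp add: matrix_vector_mult_basis[symmetric] matrix_vector_mul_assoc matrix_mul_assoc)
    also have "\<dots> = (if j = k then - axis j 1 else axis j 1)"
    proof (cases "j = k")
      case True
      have "Q *v (A *v axis j 1) = - (A *v axis j 1)" using True A Qa by simp
      then have "transpose A *v (Q *v (A *v axis j 1)) = - (transpose A *v (A *v axis j 1))"
        by (simp add: linear_neg[OF matrix_vector_mul_linear])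
      then show ?thesis using True tAx by simp
    next
      case False
      have "(A *v axis j 1) \<bullet> a = axis j 1 \<bullet> (axis k 1 :: real^'m)"
        unfolding A(2)[symmetric] by (rule orthogonal_matrix_inner[OF A(1)])
      also have "\<dots> = 0" using False by (simp add: inner_axis_axis)
      finally show ?thesis using False Qz tAx by simp
    qed
    finally show ?thesis .
  qed
  have B: "?B $ i $ j = (if j = k then - axis j 1 else axis j 1) $ i" for i j
    using col[of j] by (simp add: column_def vec_eq_iff)
  have "det ?B = (\<Prod>i\<in>UNIV. ?B $ i $ i)"
    by (rule det_diagonal) (auto simp: B axis_def)
  also have "\<dots> = (\<Prod>i\<in>UNIV. if i = k then - 1 else 1)"
    by (intro prod.cong) (auto simp: B axis_def)
  also have "\<dots> = - 1" by (simp add: prod.delta)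
  finally have "det ?B = - 1" .
  moreover have "det ?B = det Q * (det (transpose A) * det A)" by (simp add: det_mul)
  moreover have "det (transpose A) * det A = 1" unfolding det_mul[symmetric] tA by simp
  ultimately show ?thesis by simp
qed

text \<open>Without the orientation of \<open>Q\<close> the second equation would hold only up to a sign, the other sign
  being that of a reflection in the hyperplane which bisects \<open>w\<close> and \<open>Q *v w\<close>.\<close>
lemma plane_rotation_angle:
  fixes Q :: "real^'m^'m"
  assumes rot: "rotation_matrix Q" and cw: "norm c = 1" "norm w = 1" "c \<bullet> w = 0"
    and fix_T: "\<And>v. v \<in> T \<Longrightarrow> Q *v v = v"
    and dec: "\<And>z. z - (z \<bullet> c) *\<^sub>R c - (z \<bullet> w) *\<^sub>R w \<in> T"
    and orth_T: "\<And>v. v \<in> T \<Longrightarrow> c \<bullet> v = 0" "\<And>v. v \<in> T \<Longrightarrow> w \<bullet> v = 0"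
  obtains \<epsilon> where "- pi < \<epsilon>" "\<epsilon> \<le> pi" "Q *v w = sin \<epsilon> *\<^sub>R c + cos \<epsilon> *\<^sub>R w" "Q *v c = cos \<epsilon> *\<^sub>R c - sin \<epsilon> *\<^sub>R w"
proof -
  have orth: "orthogonal_matrix Q" and det: "det Q = 1" using rot by (auto simp: rotation_matrix_def)
  note ip = orthogonal_matrix_inner[OF orth]
  have cc: "c \<bullet> c = 1" "w \<bullet> w = 1" "w \<bullet> c = 0" using cw by (auto simp: norm_eq_1 inner_commute)
  have plane: "z = (z \<bullet> c) *\<^sub>R c + (z \<bullet> w) *\<^sub>R w" if "\<And>v. v \<in> T \<Longrightarrow> z \<bullet> v = 0" for z
  proof -
    let ?r = "z - (z \<bullet> c) *\<^sub>R c - (z \<bullet> w) *\<^sub>R w"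
    have r: "?r \<in> T" by (rule dec)
    have "?r \<bullet> ?r = z \<bullet> ?r - (z \<bullet> c) * (c \<bullet> ?r) - (z \<bullet> w) * (w \<bullet> ?r)"
      by (simp only: inner_diff_left[of _ _ ?r] inner_scaleR_left)
    then have "?r \<bullet> ?r = 0" using that[OF r] orth_T(1)[OF r] orth_T(2)[OF r] by simp
    then have "?r = 0" by (simp only: inner_eq_zero_iff)
    then show ?thesis by (simp add: algebra_simps)
  qed
  define x where "x = (Q *v w) \<bullet> c"
  define y where "y = (Q *v w) \<bullet> w"
  define \<alpha> where "\<alpha> = (Q *v c) \<bullet> c"
  define \<beta> where "\<beta> = (Q *v c) \<bullet> w"
  \<comment> \<open>\<open>Q\<close> preserves inner products and fixes \<open>T\<close>, so the
    images of \<open>w\<close> and \<open>c\<close> stay orthogonal to \<open>T\<close>, that is, in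
    the plane of \<open>c\<close> and \<open>w\<close>.\<close>
  have "(Q *v w) \<bullet> v = 0" if "v \<in> T" for v
    using ip[of w v] fix_T[OF that] orth_T(2)[OF that] by simp
  then have Qw: "Q *v w = x *\<^sub>R c + y *\<^sub>R w" using plane unfolding x_def y_def by blast
  have "(Q *v c) \<bullet> v = 0" if "v \<in> T" for v
    using ip[of c v] fix_T[OF that] orth_T(1)[OF that] by simp
  then have Qc: "Q *v c = \<alpha> *\<^sub>R c + \<beta> *\<^sub>R w" using plane unfolding \<alpha>_def \<beta>_def by blast
  have xy: "x\<^sup>2 + y\<^sup>2 = 1" using ip[of w w] unfolding Qw
    by (simp add: inner_add_left inner_add_right cc cw power2_eq_square)
  have ab: "\<alpha>\<^sup>2 + \<beta>\<^sup>2 = 1" using ip[of c c] unfolding Qc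
    by (simp add: inner_add_left inner_add_right cc cw power2_eq_square)
  have perp: "\<alpha> * x + \<beta> * y = 0" using ip[of c w] unfolding Qc Qw
    by (simp add: inner_add_left inner_add_right cc cw mult.commute)
  \<comment> \<open>\<open>k\<close> is the determinant of \<open>Q\<close> on this plane. Its
    square is 1 by the identity of Lagrange, because \<open>perp\<close> makes the other square
    vanish.\<close>
  define k where "k = \<alpha> * y - \<beta> * x"
  have "k\<^sup>2 + (\<alpha> * x + \<beta> * y)\<^sup>2 = (\<alpha>\<^sup>2 + \<beta>\<^sup>2) * (x\<^sup>2 + y\<^sup>2)"
    unfolding k_def by (simp add: power2_eq_square algebra_simps)
  then have "k\<^sup>2 = 1" using xy ab perp by simp
  then have k: "k = 1 \<or> k = - 1" by (simp add: power2_eq_1_iff)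
  have "\<alpha> = \<alpha> * (x\<^sup>2 + y\<^sup>2)" using xy by simp
  also have "\<dots> = k * y + x * (\<alpha> * x + \<beta> * y)" by (simp add: k_def power2_eq_square algebra_simps)
  finally have \<alpha>: "\<alpha> = k * y" using perp by simp
  have "\<beta> = \<beta> * (x\<^sup>2 + y\<^sup>2)" using xy by simp
  also have "\<dots> = - k * x + y * (\<alpha> * x + \<beta> * y)" by (simp add: k_def power2_eq_square algebra_simps)
  finally have \<beta>: "\<beta> = - k * x" using perp by simp
  obtain t where t: "0 \<le> t" "t < 2 * pi" "y = cos t" "x = sin t"
    using sincos_total_2pi[of y x] xy by (metis add.commute)
  \<comment> \<open>The turning angle is moved from [0, 2 pi) to (-pi, pi], the range that
    corresponds to the cut in \<open>angle_through\<close>.\<close>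
  define \<epsilon> where "\<epsilon> = (if t \<le> pi then t else t - 2 * pi)"
  have \<epsilon>: "- pi < \<epsilon>" "\<epsilon> \<le> pi" "y = cos \<epsilon>" "x = sin \<epsilon>"
    using t pi_gt_zero by (auto simp: \<epsilon>_def cos_diff sin_diff)
  have "k = 1"
  proof (rule ccontr)
    assume "k \<noteq> 1"
    then have "k = - 1" using k by simp
    then have Qc': "Q *v c = sin \<epsilon> *\<^sub>R w - cos \<epsilon> *\<^sub>R c" unfolding Qc \<alpha> \<beta> \<epsilon> by simp
    have Qw': "Q *v w = sin \<epsilon> *\<^sub>R c + cos \<epsilon> *\<^sub>R w" unfolding Qw \<epsilon> by simp
    \<comment> \<open>If \<open>k = - 1\<close>, then \<open>Q\<close> reflects the plane. The
      mirror is spanned by \<open>S *\<^sub>R c + C *\<^sub>R w\<close>, halfway between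
      \<open>w\<close> and its image, whence the half angles; \<open>a\<close> is the unit normal of
      the mirror.\<close>
    define S where "S = sin (\<epsilon> / 2)"
    define C where "C = cos (\<epsilon> / 2)"
    have CS: "C\<^sup>2 + S\<^sup>2 = 1" unfolding C_def S_def by simp
    have half: "C * sin \<epsilon> - S * cos \<epsilon> = S" "C * cos \<epsilon> + S * sin \<epsilon> = C"
      using sin_diff[of \<epsilon> "\<epsilon> / 2"] cos_diff[of \<epsilon> "\<epsilon> / 2"]
      by (simp_all add: C_def S_def mult.commute add.commute)
    define a where "a = S *\<^sub>R w - C *\<^sub>R c"
    have "a \<bullet> a = 1" unfolding a_def using CS
      by (simp add: inner_diff_left inner_diff_right cc cw power2_eq_square)
    then have "norm a = 1" by (simp add: norm_eq_1)
    moreover have "Q *v a = - a"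
    proof -
      have "Q *v a = S *\<^sub>R (Q *v w) - C *\<^sub>R (Q *v c)"
        by (simp add: a_def matrix_vector_mult_diff_distrib matrix_vector_mult_scaleR)
      also have "\<dots> = (C * cos \<epsilon> + S * sin \<epsilon>) *\<^sub>R c - (C * sin \<epsilon> - S * cos \<epsilon>) *\<^sub>R w"
        unfolding Qw' Qc' by (simp add: algebra_simps)
      also have "\<dots> = - a" unfolding half a_def by simp
      finally show ?thesis .
    qed
    moreover have "Q *v z = z" if "z \<bullet> a = 0" for z
    proof -
      let ?v = "z - (z \<bullet> c) *\<^sub>R c - (z \<bullet> w) *\<^sub>R w"
      \<comment> \<open>Orthogonality to \<open>a\<close> forces the plane component of
        \<open>z\<close> to be \<open>l\<close> times the mirror direction, which \<open>Q\<close>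
        fixes.\<close>
      define l where "l = (z \<bullet> c) * S + (z \<bullet> w) * C"
      have 0: "(z \<bullet> w) * S = (z \<bullet> c) * C" using that by (simp add: a_def inner_diff_right mult.commute)
      have "(z \<bullet> c) = (z \<bullet> c) * (C\<^sup>2 + S\<^sup>2)" using CS by simp
      also have "\<dots> = ((z \<bullet> c) * C) * C + (z \<bullet> c) * S * S" by (simp add: power2_eq_square algebra_simps)
      also have "\<dots> = l * S" unfolding 0[symmetric] by (simp add: l_def algebra_simps)
      finally have zc: "z \<bullet> c = l * S" .
      have "(z \<bullet> w) = (z \<bullet> w) * (C\<^sup>2 + S\<^sup>2)" using CS by simp
      also have "\<dots> = ((z \<bullet> w) * S) * S + (z \<bullet> w) * C * C" by (simp add: power2_eq_square algebra_simps)
      also have "\<dots> = l * C" unfolding 0 by (simp add: l_def algebra_simps)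
      finally have zw: "z \<bullet> w = l * C" .
      have "z = ?v + (l * S) *\<^sub>R c + (l * C) *\<^sub>R w" unfolding zc zw by simp
      then have "Q *v z = Q *v (?v + (l * S) *\<^sub>R c + (l * C) *\<^sub>R w)" by (rule arg_cong)
      also have "\<dots> = ?v + (l * S) *\<^sub>R (Q *v c) + (l * C) *\<^sub>R (Q *v w)"
        using fix_T[OF dec[of z]] by (simp add: matrix_vector_right_distrib matrix_vector_mult_scaleR)
      also have "\<dots> = ?v + (l * (C * sin \<epsilon> - S * cos \<epsilon>)) *\<^sub>R c + (l * (C * cos \<epsilon> + S * sin \<epsilon>)) *\<^sub>R w"
        unfolding Qw' Qc' by (simp add: algebra_simps)
      also have "\<dots> = z" unfolding half zc[symmetric] zw[symmetric] by simp
      finally show ?thesis .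
    qed
    ultimately have "det Q = - 1" by (rule det_reflection)
    then show False using det by simp
  qed
  then show ?thesis using that[of \<epsilon>] \<epsilon> Qw Qc \<alpha> \<beta> by simp
qed

text \<open>As \<open>\<epsilon>\<close> runs through (-pi, pi], \<open>pi / 2 - \<epsilon>\<close>
  runs through [-pi/2, 3 pi/2), precisely the range prescribed in \<open>angle_through\<close>. Sine
  and cosine determine the angle there.\<close>

lemma angle_through_complement:
  assumes cw: "norm c = 1" "norm w = 1" "c \<bullet> w = 0" and \<epsilon>: "- pi < \<epsilon>" "\<epsilon> \<le> pi"
  shows "angle_through c w (sin \<epsilon> *\<^sub>R c + cos \<epsilon> *\<^sub>R w) = pi / 2 - \<epsilon>"
  unfolding angle_through_def
proof (rule the_equality)
  show "- (pi / 2) \<le> pi / 2 - \<epsilon> \<and> pi / 2 - \<epsilon> < 3 * pi / 2 \<and>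
    sin \<epsilon> *\<^sub>R c + cos \<epsilon> *\<^sub>R w = cos (pi / 2 - \<epsilon>) *\<^sub>R c + sin (pi / 2 - \<epsilon>) *\<^sub>R w"
    using \<epsilon> by (auto simp: cos_diff sin_diff)
next
  have ip: "c \<bullet> c = 1" "w \<bullet> w = 1" "w \<bullet> c = 0" using cw by (auto simp: norm_eq_1 inner_commute)
  fix \<phi> assume \<phi>: "- (pi / 2) \<le> \<phi> \<and> \<phi> < 3 * pi / 2 \<and>
    sin \<epsilon> *\<^sub>R c + cos \<epsilon> *\<^sub>R w = cos \<phi> *\<^sub>R c + sin \<phi> *\<^sub>R w"
  then have eq: "sin \<epsilon> *\<^sub>R c + cos \<epsilon> *\<^sub>R w = cos \<phi> *\<^sub>R c + sin \<phi> *\<^sub>R w" by blast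
  have "sin \<epsilon> = cos \<phi>" using arg_cong[OF eq, of "\<lambda>z. z \<bullet> c"] by (simp add: inner_add_left ip)
  moreover have "cos \<epsilon> = sin \<phi>" using arg_cong[OF eq, of "\<lambda>z. z \<bullet> w"] by (simp add: inner_add_left ip cw)
  ultimately have "sin (pi / 2 - \<epsilon>) = sin \<phi> \<and> cos (pi / 2 - \<epsilon>) = cos \<phi>" by (simp add: cos_diff sin_diff)
  then obtain m :: int where m: "pi / 2 - \<epsilon> = \<phi> + 2 * pi * m" unfolding sin_cos_eq_iff by blast
  have "2 * pi * m < 2 * pi * 1" "2 * pi * (- 1) < 2 * pi * m"
    using m \<phi>[THEN conjunct1] \<phi>[THEN conjunct2, THEN conjunct1] \<epsilon> by linarith+
  then have "real_of_int m < 1" "- 1 < real_of_int m"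
    using mult_less_cancel_left_pos[of "2 * pi"] pi_gt_zero by (metis mult_pos_pos zero_less_numeral)+
  then have "m = 0" by simp
  then show "\<phi> = pi / 2 - \<epsilon>" using m by simp
qed

text \<open>The value \<open>\<epsilon> = pi\<close> is a complete fold; there the two normals cancel and \<^const>\<open>signed_angle\<close>
  would return \<open>- pi\<close>.\<close>
lemma signed_angle_rotation:
  assumes cw: "norm c = 1" "norm w = 1" "c \<bullet> w = 0" and \<epsilon>: "- pi < \<epsilon>" "\<epsilon> < pi"
    and b: "b = sin \<epsilon> *\<^sub>R c + cos \<epsilon> *\<^sub>R w" and c': "c' = cos \<epsilon> *\<^sub>R c - sin \<epsilon> *\<^sub>R w"
  shows "signed_angle (c + c') w b = \<epsilon>"
proof -
  have ip: "c \<bullet> c = 1" "w \<bullet> w = 1" "w \<bullet> c = 0" using cw by (auto simp: norm_eq_1 inner_commute)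
  \<comment> \<open>Tested against the sum of the two normals, the change of the tangent is
    \<open>2 * sin \<epsilon>\<close>, so its sign is the sign of \<open>\<epsilon>\<close> between
    -pi and pi. For \<open>\<epsilon> = 0\<close> the negative branch returns 0 as well.\<close>
  have "(b - w) \<bullet> (c + c') = sin \<epsilon> * (1 + cos \<epsilon>) - (cos \<epsilon> - 1) * sin \<epsilon>"
    unfolding b c' by (simp add: inner_diff_left inner_diff_right inner_add_left inner_add_right ip cw algebra_simps)
  then have 1: "(b - w) \<bullet> (c + c') = 2 * sin \<epsilon>" by (simp add: algebra_simps)
  have 2: "w \<bullet> b = cos \<epsilon>" unfolding b by (simp add: inner_add_right ip)
  show ?thesis
  proof (cases "\<epsilon> > 0")
    case True
    then have "sin \<epsilon> > 0" using \<epsilon> by (intro sin_gt_zero) auto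
    then show ?thesis unfolding signed_angle_def 1 2 using True \<epsilon> by (simp add: arccos_cos)
  next
    case False
    then have "sin (- \<epsilon>) \<ge> 0" using \<epsilon> by (intro sin_ge_zero) auto
    then show ?thesis unfolding signed_angle_def 1 2 using False \<epsilon> arccos_cos[of "- \<epsilon>"] by simp
  qed
qed

text \<open>Traversing a geodesic backwards exchanges and negates its end tangents. The turning
  therefore depends neither on the direction of travel nor on the order of the two
  simplices.\<close>

lemma signed_angle_reverse: "signed_angle c (- b) (- a) = signed_angle c a b"
  by (simp add: signed_angle_def inner_commute)

section \<open>Complexes and hinges\<close>

lemma star_iff: "x \<in> star K s \<longleftrightarrow> (\<exists>t \<in> K. s \<subseteq> t \<and> x \<in> rel_interior t)"
  by (auto simp: star_def)

text \<open>Induction on dimension: a point outside the relative interior lies on a proper face. The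
  measure adds 1 because the affine dimension of the empty set is -1.\<close>

lemma polytope_rel_interior_face:
  fixes s :: "'a::euclidean_space set"
  assumes "polytope s" "x \<in> s"
  obtains f where "f face_of s" "x \<in> rel_interior f"
proof -
  have "\<exists>f. f face_of s \<and> x \<in> rel_interior f"
    using assms
  proof (induction "nat (aff_dim s + 1)" arbitrary: s rule: less_induct)
    case less
    show ?case
    proof (cases "x \<in> rel_interior s")
      case True
      then show ?thesis using less.prems face_of_refl polytope_imp_convex by blast
    next
      case False
      then have "x \<in> rel_frontier s"
        using less.prems closure_subset by (auto simp: rel_frontier_def)
      then obtain f where f: "f face_of s" "f \<noteq> s" "x \<in> f"
        using rel_frontier_of_polyhedron_alt[OF polytope_imp_polyhedron[OF less.prems(1)]] by blast
      have "aff_dim f < aff_dim s"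
        using face_of_aff_dim_lt f less.prems polytope_imp_convex by blast
      then have "nat (aff_dim f + 1) < nat (aff_dim s + 1)"
        using aff_dim_geq[of f] by linarith
      then obtain g where "g face_of f" "x \<in> rel_interior g"
        using less.hyps f less.prems face_of_polytope_polytope by blast
      then show ?thesis using f face_of_trans by blast
    qed
  qed
  then show ?thesis using that by blast
qed

section \<open>Locally finite complexes\<close>

locale complex =
  fixes K :: "'a::euclidean_space set set"
  assumes complex: "locally_finite_complex K"
begin

lemma simplex_ex: "s \<in> K \<Longrightarrow> \<exists>k. k simplex s"
  using complex by (auto simp: locally_finite_complex_def)

lemma faces_closed: "s \<in> K \<Longrightarrow> f face_of s \<Longrightarrow> f \<in> K"
  using complex by (auto simp: locally_finite_complex_def)

lemma locally_finite: "x \<in> \<Union>K \<Longrightarrow> \<exists>U. open U \<and> x \<in> U \<and> finite {s \<in> K. s \<inter> U \<noteq> {}}"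
  using complex unfolding locally_finite_complex_def by blast

lemma inter_face: "s \<in> K \<Longrightarrow> t \<in> K \<Longrightarrow> s \<inter> t face_of s"
  using complex unfolding locally_finite_complex_def by blast

lemma K_closed: "s \<in> K \<Longrightarrow> closed s"
  using simplex_ex closed_simplex by blast

lemma K_convex: "s \<in> K \<Longrightarrow> convex s"
  using simplex_ex convex_simplex by blast

lemma subset_imp_face: "s \<in> K \<Longrightarrow> t \<in> K \<Longrightarrow> s \<subseteq> t \<Longrightarrow> s face_of t"
  using inter_face[of t s] by (simp add: Int_absorb1)

text \<open>\<open>s \<inter> t\<close> is a face of \<open>s\<close> containing a relatively
  interior point of \<open>s\<close>, and such a face is all of \<open>s\<close>.\<close>

lemma rel_interior_imp_subset:
  assumes "s \<in> K" "t \<in> K" "x \<in> rel_interior s" "x \<in> t"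
  shows "s \<subseteq> t"
  using subset_of_face_of[OF inter_face[OF assms(1,2)], of s] assms(3,4) rel_interior_subset by blast

lemma rel_interior_unique:
  assumes "s \<in> K" "t \<in> K" "x \<in> rel_interior s" "x \<in> rel_interior t"
  shows "s = t"
  using rel_interior_imp_subset[OF assms(1-3)] rel_interior_imp_subset[OF assms(2,1,4)]
    assms(3,4) rel_interior_subset by blast

lemma carrier_exists:
  assumes "t \<in> K" "x \<in> t"
  obtains f where "f \<in> K" "f face_of t" "x \<in> rel_interior f"
proof -
  have "polytope t" using simplex_ex[OF assms(1)] simplex_imp_polytope by blast
  then show ?thesis using polytope_rel_interior_face[OF _ assms(2)] faces_closed[OF assms(1)] that by blast
qed

text \<open>Near a point of the star only finitely many simplices occur. Those not containing
  \<open>s\<close> form a closed set that misses the point, and off this set the carrier of every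
  point contains \<open>s\<close>.\<close>

lemma star_open: "openin (top_of_set (\<Union>K)) (star K s)"
proof (subst openin_subopen, intro ballI)
  fix x assume "x \<in> star K s"
  then obtain t where t: "t \<in> K" "s \<subseteq> t" "x \<in> rel_interior t" by (auto simp: star_iff)
  have xK: "x \<in> \<Union>K" using t rel_interior_subset by blast
  then obtain U where U: "open U" "x \<in> U" "finite {s \<in> K. s \<inter> U \<noteq> {}}" using locally_finite by blast
  define F where "F = {t' \<in> {s \<in> K. s \<inter> U \<noteq> {}}. \<not> s \<subseteq> t'}"
  have "finite F" using U(3) by (rule rev_finite_subset) (auto simp: F_def)
  then have clF: "closed (\<Union>F)" using K_closed by (intro closed_Union) (auto simp: F_def)
  have "x \<notin> \<Union>F"
    using rel_interior_imp_subset[OF t(1) _ t(3)] t(2) by (auto simp: F_def)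
  moreover have "(U - \<Union>F) \<inter> \<Union>K \<subseteq> star K s"
  proof
    fix y assume y: "y \<in> (U - \<Union>F) \<inter> \<Union>K"
    then obtain t1 where "t1 \<in> K" "y \<in> t1" by blast
    then obtain f where f: "f \<in> K" "y \<in> rel_interior f" using carrier_exists by blast
    have "y \<in> f" using f rel_interior_subset by blast
    then have "s \<subseteq> f" using y f by (auto simp: F_def)
    then show "y \<in> star K s" using f by (auto simp: star_iff)
  qed
  moreover have "openin (top_of_set (\<Union>K)) ((U - \<Union>F) \<inter> \<Union>K)"
    using open_Diff[OF U(1) clF] by (simp add: openin_open_Int Int_commute)
  ultimately show "\<exists>T. openin (top_of_set (\<Union>K)) T \<and> x \<in> T \<and> T \<subseteq> star K s"
    using U(2) xK by blast
qed

lemma k_simplices_subset_eq: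
  assumes "s \<in> k_simplices K k" "t \<in> k_simplices K k" "s \<subseteq> t"
  shows "s = t"
proof -
  have "s face_of t" using assms subset_imp_face by (auto simp: k_simplices_def)
  moreover have "aff_dim s = aff_dim t"
    using aff_dim_simplex[of "int k" s] aff_dim_simplex[of "int k" t] assms by (simp add: k_simplices_def)
  ultimately show ?thesis
    using face_of_aff_dim_lt[of t s] assms K_convex[of t] unfolding k_simplices_def by fastforce
qed

end

section \<open>Piecewise flat submanifolds with a chosen normal\<close>

locale pf_submanifold = complex K for K :: "(real ^ 'm) set set" +
  fixes n :: nat and N :: "(real ^ 'm) set \<Rightarrow> real ^ 'm"
  assumes n_pos: "n \<ge> 1"
    and manifold: "piecewise_flat_submanifold n K"
    and normal: "positive_normal n K N"
begin

lemma in_top_simplex: "s \<in> K \<Longrightarrow> \<exists>t \<in> k_simplices K n. s \<subseteq> t"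
  using manifold by (auto simp: piecewise_flat_submanifold_def)

lemma hinge_pair_exists: "h \<in> hinges n K \<Longrightarrow> \<exists>s t. hinge_pair n K h s t"
  using manifold by (auto simp: piecewise_flat_submanifold_def)

lemma hinge_pair_commute: "hinge_pair n K h s t \<Longrightarrow> hinge_pair n K h t s"
  unfolding hinge_pair_def by auto

lemma simplex_facetI:
  assumes "h \<in> hinges n K" "s \<in> k_simplices K n" "h \<subseteq> s"
  shows "simplex_facet n h s"
proof
  show "h face_of s" using assms subset_imp_face by (auto simp: hinges_def k_simplices_def)
qed (use assms n_pos in \<open>auto simp: hinges_def k_simplices_def\<close>)

text \<open>Together with \<open>star_open\<close> this makes the open n-simplices open in the
  submanifold.\<close>

lemma top_simplex_star:
  assumes "u \<in> k_simplices K n"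
  shows "star K u = rel_interior u"
proof -
  have uniq: "t = u" if t: "t \<in> K" "u \<subseteq> t" for t
  proof -
    obtain t' where t': "t' \<in> k_simplices K n" "t \<subseteq> t'" using in_top_simplex t by blast
    then have "u = t'" using k_simplices_subset_eq[OF assms] t by blast
    then show ?thesis using t' t by blast
  qed
  have "u \<in> K" using assms by (simp add: k_simplices_def)
  then show ?thesis using uniq by (intro set_eqI) (metis star_iff order_refl)
qed

end

section \<open>The two simplices at a hinge\<close>

locale hinge = pf_submanifold K n N for K :: "(real ^ 'm) set set" and n N +
  fixes h s t :: "(real ^ 'm) set"
  assumes pair: "hinge_pair n K h s t"
begin

lemma h_hinge: "h \<in> hinges n K" and s_neq_t: "s \<noteq> t"
  and s_top: "s \<in> k_simplices K n" and t_top: "t \<in> k_simplices K n"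
  and h_sub_s: "h \<subseteq> s" and h_sub_t: "h \<subseteq> t"
  using pair by (auto simp: hinge_pair_def)

lemma in_K: "h \<in> K" "s \<in> K" "t \<in> K"
  using h_hinge s_top t_top by (auto simp: hinges_def k_simplices_def)

sublocale s: simplex_facet n h s by (rule simplex_facetI[OF h_hinge s_top h_sub_s])
sublocale t: simplex_facet n h t by (rule simplex_facetI[OF h_hinge t_top h_sub_t])

text \<open>Equal inward vectors would lead from a point of the hinge into the interiors of both
  simplices at once. This excludes a complete fold.\<close>

lemma inward_neq: "inward h s \<noteq> inward h t"
proof
  assume eq: "inward h s = inward h t"
  obtain q where q: "q \<in> rel_interior h" by (rule s.h_rel_interior_nonempty)
  obtain d where d: "d > 0" "\<And>r. 0 < r \<and> r < d \<Longrightarrow> q + r *\<^sub>R inward h s \<in> rel_interior s"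
    using s.facet_normal_enters[OF s.facet_normal_inward q] by blast
  obtain d' where d': "d' > 0" "\<And>r. 0 < r \<and> r < d' \<Longrightarrow> q + r *\<^sub>R inward h t \<in> rel_interior t"
    using t.facet_normal_enters[OF t.facet_normal_inward q] by blast
  define r where "r = min d d' / 2"
  have "0 < r" "r < d" "r < d'" using d(1) d'(1) by (auto simp: r_def min_def)
  then have "s = t" using rel_interior_unique[OF in_K(2,3)] d(2) d'(2) unfolding eq by blast
  then show False using s_neq_t by simp
qed

lemma star_subset: "star K h \<subseteq> s \<union> t"
proof
  fix x assume "x \<in> star K h"
  then obtain f where f: "f \<in> K" "h \<subseteq> f" "x \<in> rel_interior f" by (auto simp: star_iff)
  obtain u where u: "u \<in> k_simplices K n" "f \<subseteq> u" using in_top_simplex[OF f(1)] by blast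
  then have "u \<in> {s, t}" using pair f(2) unfolding hinge_pair_def by blast
  then show "x \<in> s \<union> t" using f u rel_interior_subset by blast
qed

lemma bounded_star: "bounded (star K h)"
proof -
  have "bounded (s \<union> t)"
    using compact_simplex[OF s.s_simplex] compact_simplex[OF t.s_simplex] by (simp add: compact_imp_bounded)
  then show ?thesis using star_subset bounded_subset by blast
qed

lemma normal_s: "norm (N s) = 1" "\<And>w. w \<in> tangent_space s \<Longrightarrow> N s \<bullet> w = 0"
  using normal s_top by (auto simp: positive_normal_def)

text \<open>Here the codimension enters: the ambient dimension is \<open>n + 1\<close>, so one
  inclusion and equal dimensions suffice. It allows every vector to be split along
  \<open>N s\<close>, \<open>inward h s\<close> and the hinge.\<close>

lemma tangent_space_hyperplane: "tangent_space s = {x. N s \<bullet> x = 0}"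
proof (rule subspace_dim_equal)
  obtain p where p: "p \<in> s" using simplex_nonempty[OF s.s_simplex] by blast
  have "int (dim (tangent_space s)) = aff_dim s"
    using aff_dim_eq_dim_subtract[of p s] p
    by (simp add: tangent_space_eq_span[OF p] hull_inc)
  then have "dim (tangent_space s) = n" using aff_dim_simplex[OF s.s_simplex] by simp
  moreover have "dim {x. N s \<bullet> x = 0} = n"
    using manifold normal_s(1) dim_hyperplane[of "N s"] by (force simp: piecewise_flat_submanifold_def)
  ultimately show "dim {x. N s \<bullet> x = 0} \<le> dim (tangent_space s)" by simp
qed (use normal_s in \<open>auto simp: subspace_tangent_space subspace_hyperplane\<close>)

text \<open>The matrix supplied by \<open>positive_normal\<close> is a rotation of the plane of
  \<open>N s\<close> and \<open>- inward h s\<close>, the hinge directions being fixed. Its angle is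
  the common value of the two sides.\<close>

lemma pair_turning:
  "pi / 2 - angle_through (N s) (- inward h s) (inward h t) = signed_angle (N s + N t) (- inward h s) (inward h t)"
proof -
  let ?c = "N s" and ?w = "- inward h s"
  obtain Q where Q: "rotation_matrix Q" "\<And>w. w \<in> tangent_space h \<Longrightarrow> Q *v w = w"
    "Q *v (- inward h s) = inward h t" "Q *v N s = N t"
    using normal pair unfolding positive_normal_def by blast
  have fn: "facet_normal h s (inward h s)" by (rule s.facet_normal_inward)
  have cw: "norm ?c = 1" "norm ?w = 1" "?c \<bullet> ?w = 0"
    using normal_s fn by (simp_all add: facet_normal_def)
  have dec: "z - (z \<bullet> ?c) *\<^sub>R ?c - (z \<bullet> ?w) *\<^sub>R ?w \<in> tangent_space h" for z
  proof -
    let ?z = "z - (z \<bullet> ?c) *\<^sub>R ?c"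
    have "?z \<in> tangent_space s"
      unfolding tangent_space_hyperplane using cw(1) by (simp add: inner_diff_right norm_eq_1 inner_commute)
    then have "?z - (?z \<bullet> inward h s) *\<^sub>R inward h s \<in> tangent_space h"
      using fn by (simp add: facet_normal_def)
    then show ?thesis using cw(3) by (simp add: inner_diff_left)
  qed
  have "tangent_space h \<subseteq> tangent_space s" by (intro tangent_space_mono h_sub_s)
  then have cv: "?c \<bullet> v = 0" if "v \<in> tangent_space h" for v using that normal_s(2) by blast
  have wv: "?w \<bullet> v = 0" if "v \<in> tangent_space h" for v using that fn by (simp add: facet_normal_def)
  obtain \<epsilon> where \<epsilon>: "- pi < \<epsilon>" "\<epsilon> \<le> pi" "Q *v ?w = sin \<epsilon> *\<^sub>R ?c + cos \<epsilon> *\<^sub>R ?w"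
    "Q *v ?c = cos \<epsilon> *\<^sub>R ?c - sin \<epsilon> *\<^sub>R ?w"
    by (rule plane_rotation_angle[OF Q(1) cw Q(2) dec cv wv])
  \<comment> \<open>A half turn would carry \<open>- inward h s\<close> to
    \<open>inward h s\<close>, making the two inward vectors equal.\<close>
  have "\<epsilon> \<noteq> pi" using \<epsilon>(3) inward_neq unfolding Q by auto
  then have "\<epsilon> < pi" using \<epsilon> by simp
  then show ?thesis
    using signed_angle_rotation[OF cw \<epsilon>(1) _ \<epsilon>(3,4)] angle_through_complement[OF cw \<epsilon>(1,2)] \<epsilon>(3)
    unfolding Q by simp
qed

end

context hinge
begin

lemma hinge_sym: "hinge K n N h t s"
  by unfold_locales (rule hinge_pair_commute[OF pair])

text \<open>The pair is determined up to order, and the exchanged order gives the same value by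
  reversal of the tangents.\<close>

lemma hinge_angle_eq:
  "hinge_angle n K N h = signed_angle (N s + N t) (- inward h s) (inward h t)"
  unfolding hinge_angle_def
proof (rule the_equality)
  show "\<exists>s' t'. hinge_pair n K h s' t' \<and> signed_angle (N s + N t) (- inward h s) (inward h t) =
      pi / 2 - angle_through (N s') (- inward h s') (inward h t')"
    using pair pair_turning by metis
  fix \<epsilon> assume "\<exists>s' t'. hinge_pair n K h s' t' \<and> \<epsilon> = pi / 2 - angle_through (N s') (- inward h s') (inward h t')"
  then obtain s' t' where *: "hinge_pair n K h s' t'" "\<epsilon> = pi / 2 - angle_through (N s') (- inward h s') (inward h t')"
    by blast
  then have "{s', t'} = {s, t}" using pair unfolding hinge_pair_def by metis
  then consider "s' = s" "t' = t" | "s' = t" "t' = s" by (metis doubleton_eq_iff)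
  then show "\<epsilon> = signed_angle (N s + N t) (- inward h s) (inward h t)"
  proof cases
    case 1 then show ?thesis using * pair_turning by simp
  next
    case 2
    then have "\<epsilon> = signed_angle (N t + N s) (- inward h t) (inward h s)"
      using * hinge.pair_turning[OF hinge_sym] by simp
    also have "\<dots> = signed_angle (N s + N t) (- inward h s) (inward h t)"
      using signed_angle_reverse[of "N s + N t" "inward h t" "- inward h s"] by (simp add: add.commute)
    finally show ?thesis .
  qed
qed

lemma hinge_angle_eq':
  "hinge_angle n K N h = signed_angle (N s + N t) (- inward h t) (inward h s)"
  using signed_angle_reverse[of "N s + N t" "inward h t" "- inward h s"] hinge_angle_eq by simp

end

section \<open>The curvature integral of a piece\<close>

text \<open>The cross-section orthogonal to \<open>e 0\<close> carries the indices 1 to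
  \<open>n - 1\<close>, whereas \<open>flat_volume\<close> counts from 0.\<close>

lemma PiM_lborel_reindex:
  assumes f: "bij_betw f I J" and I: "finite I"
  shows "distr (Pi\<^sub>M J (\<lambda>_. lborel)) (Pi\<^sub>M I (\<lambda>_. lborel)) (\<lambda>y. \<lambda>i\<in>I. y (f i)) = Pi\<^sub>M I (\<lambda>_. lborel :: real measure)"
proof (rule lborel_product.PiM_eqI[OF I])
  let ?J = "Pi\<^sub>M J (\<lambda>_. lborel :: real measure)" and ?I = "Pi\<^sub>M I (\<lambda>_. lborel :: real measure)"
  fix A :: "'a \<Rightarrow> real set" assume A: "\<And>i. i \<in> I \<Longrightarrow> A i \<in> sets lborel"
  define g where "g = inv_into I f"
  have fJ: "f i \<in> J" if "i \<in> I" for i using f that by (auto simp: bij_betw_def)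
  have gI: "g j \<in> I" "f (g j) = j" if "j \<in> J" for j
    using f that by (auto simp: g_def bij_betw_def inv_into_into f_inv_into_f)
  have gf: "g (f i) = i" if "i \<in> I" for i using f that by (auto simp: g_def bij_betw_def)
  have J: "finite J" using f I bij_betw_finite by blast
  have m: "(\<lambda>y. \<lambda>i\<in>I. y (f i)) \<in> measurable ?J ?I"
    using fJ by (intro measurable_restrict measurable_component_singleton)
  have "emeasure (distr ?J ?I (\<lambda>y. \<lambda>i\<in>I. y (f i))) (Pi\<^sub>E I A) =
      emeasure ?J ((\<lambda>y. \<lambda>i\<in>I. y (f i)) -` Pi\<^sub>E I A \<inter> space ?J)"
    using A m I by (intro emeasure_distr) (auto intro!: sets_PiM_I_finite)
  also have "(\<lambda>y. \<lambda>i\<in>I. y (f i)) -` Pi\<^sub>E I A \<inter> space ?J = Pi\<^sub>E J (\<lambda>j. A (g j))"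
  proof (intro set_eqI iffI)
    fix y assume y: "y \<in> (\<lambda>y. \<lambda>i\<in>I. y (f i)) -` Pi\<^sub>E I A \<inter> space ?J"
    have "y j \<in> A (g j)" if "j \<in> J" for j
    proof -
      have "y (f (g j)) \<in> A (g j)" using y gI(1)[OF that] by (auto simp: PiE_iff)
      then show ?thesis using gI(2)[OF that] by simp
    qed
    then show "y \<in> Pi\<^sub>E J (\<lambda>j. A (g j))" using y by (auto simp: space_PiM PiE_iff)
  next
    fix y assume y: "y \<in> Pi\<^sub>E J (\<lambda>j. A (g j))"
    have "y (f i) \<in> A i" if "i \<in> I" for i
      using y fJ[OF that] gf[OF that] by (auto simp: PiE_iff)
    then show "y \<in> (\<lambda>y. \<lambda>i\<in>I. y (f i)) -` Pi\<^sub>E I A \<inter> space ?J"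
      using y by (auto simp: space_PiM PiE_iff)
  qed
  also have "emeasure ?J \<dots> = (\<Prod>j\<in>J. emeasure lborel (A (g j)))"
    using J A gI by (subst lborel_product.emeasure_PiM) auto
  also have "\<dots> = (\<Prod>i\<in>I. emeasure lborel (A (g (f i))))"
    by (rule prod.reindex_bij_betw[OF f, symmetric])
  also have "\<dots> = (\<Prod>i\<in>I. emeasure lborel (A i))" using gf by (intro prod.cong) auto
  finally show "emeasure (distr ?J ?I (\<lambda>y. \<lambda>i\<in>I. y (f i))) (Pi\<^sub>E I A) = (\<Prod>i\<in>I. emeasure lborel (A i))" .
qed simp

lemma AE_PiM_lborel_coordinate:
  assumes "finite I" "i \<in> I"
  shows "AE y in Pi\<^sub>M I (\<lambda>_. lborel). y i \<noteq> (c :: real)"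
proof (rule AE_I[where N = "Pi\<^sub>E I (\<lambda>j. if j = i then {c} else UNIV)"])
  show "{y \<in> space (Pi\<^sub>M I (\<lambda>_. lborel)). \<not> y i \<noteq> c} \<subseteq> Pi\<^sub>E I (\<lambda>j. if j = i then {c} else UNIV)"
    by (auto simp: space_PiM PiE_iff extensional_def)
  show "emeasure (Pi\<^sub>M I (\<lambda>_. lborel)) (Pi\<^sub>E I (\<lambda>j. if j = i then {c} else UNIV)) = 0"
    using assms by (subst lborel_product.emeasure_PiM) (auto intro!: prod_zero bexI[of _ i])
  show "Pi\<^sub>E I (\<lambda>j. if j = i then {c} else UNIV) \<in> sets (Pi\<^sub>M I (\<lambda>_. lborel))"
    using assms by (intro sets_PiM_I_finite) auto
qed

text \<open>The derivative is constant on each side of the bend, so the limits at the ends of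
  \<open>I\<close> see only one arm each. Against the parameter the left arm points along
  \<open>b\<close>, whence the tangent \<open>- b\<close>.\<close>

lemma broken_line_tangents:
  fixes a b q :: "'a::euclidean_space"
  defines "\<gamma> \<equiv> (\<lambda>r::real. q + (if 0 \<le> r then r *\<^sub>R a else (- r) *\<^sub>R b))"
  assumes I: "Inf I < 0" "0 < Sup I"
  shows "initial_tangent \<gamma> I = - b" "final_tangent \<gamma> I = a"
proof -
  have l: "vector_derivative \<gamma> (at r) = - b" if "r < 0" for r
  proof (rule vector_derivative_at)
    have "((\<lambda>r. q + (- r) *\<^sub>R b) has_vector_derivative - b) (at r)"
      by (auto intro!: derivative_eq_intros)
    then show "(\<gamma> has_vector_derivative - b) (at r)"
      by (rule has_vector_derivative_transform_within_open[of _ _ _ "{..<0}"])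
        (use that in \<open>auto simp: \<gamma>_def\<close>)
  qed
  have r: "vector_derivative \<gamma> (at r) = a" if "r > 0" for r
  proof (rule vector_derivative_at)
    have "((\<lambda>r. q + r *\<^sub>R a) has_vector_derivative a) (at r)"
      by (auto intro!: derivative_eq_intros)
    then show "(\<gamma> has_vector_derivative a) (at r)"
      by (rule has_vector_derivative_transform_within_open[of _ _ _ "{0<..}"])
        (use that in \<open>auto simp: \<gamma>_def\<close>)
  qed
  have "eventually (\<lambda>r. vector_derivative \<gamma> (at r) = - b) (at_right (Inf I))"
    using I l unfolding eventually_at_right[OF I(1)] by auto
  then show "initial_tangent \<gamma> I = - b"
    unfolding initial_tangent_def by (intro tendsto_Lim tendsto_eventually) auto
  have "eventually (\<lambda>r. vector_derivative \<gamma> (at r) = a) (at_left (Sup I))"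
    using I r unfolding eventually_at_left[OF I(2)] by auto
  then show "final_tangent \<gamma> I = a"
    unfolding final_tangent_def by (intro tendsto_Lim tendsto_eventually) auto
qed

lemma borel_rel_interior: "rel_interior (s :: 'a::euclidean_space set) \<in> sets borel"
proof -
  obtain U where "open U" "rel_interior s = affine hull s \<inter> U"
    using openin_rel_interior[of s] by (auto simp: openin_open)
  moreover have "closed (affine hull s)" by (rule closed_affine_hull)
  ultimately show ?thesis by auto
qed

lemma (in complex) borel_openin_rel_interior:
  assumes D: "openin (top_of_set (\<Union>K)) D" and f: "f \<in> K"
  shows "rel_interior f \<inter> D \<in> sets borel"
proof -
  obtain U where U: "open U" "D = \<Union>K \<inter> U" using D by (auto simp: openin_open)
  then have "rel_interior f \<inter> D = rel_interior f \<inter> U" using f rel_interior_subset by blast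
  then show ?thesis using borel_rel_interior[of f] borel_open[OF U(1)] by (simp add: sets.Int)
qed

section \<open>A piece in the star of one hinge\<close>

locale hinge_piece = hinge K n N h s t
  for K :: "(real ^ 'm) set set" and n N h s t +
  fixes p :: "real ^ 'm" and e :: "nat \<Rightarrow> real ^ 'm" and D :: "(real ^ 'm) set"
  assumes frame: "hinge_frame n h s p e"
    and D_star: "D \<subseteq> star K h"
    and D_open: "openin (top_of_set (\<Union>K)) D"
begin

abbreviation "us \<equiv> inward h s"
abbreviation "ut \<equiv> inward h t"

lemma fn_s: "facet_normal h s us" and fn_t: "facet_normal h t ut"
  by (rule s.facet_normal_inward t.facet_normal_inward)+

lemma us: "norm us = 1" "us \<bullet> us = 1" "us \<in> tangent_space s" "w \<in> tangent_space h \<Longrightarrow> us \<bullet> w = 0"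
    "w \<in> tangent_space h \<Longrightarrow> w \<bullet> us = 0"
  using fn_s by (simp_all add: facet_normal_def norm_eq_1 inner_commute)

lemma us_dec: "w \<in> tangent_space s \<Longrightarrow> w - (w \<bullet> us) *\<^sub>R us \<in> tangent_space h"
  using fn_s by (simp add: facet_normal_def)

lemma ut: "norm ut = 1" "ut \<bullet> ut = 1" "w \<in> tangent_space h \<Longrightarrow> ut \<bullet> w = 0"
  using fn_t by (simp_all add: facet_normal_def norm_eq_1)

lemma fam: "orthonormal_family n e" and p_hull: "p \<in> affine hull h"
  and e0: "w \<in> tangent_space h \<Longrightarrow> e 0 \<bullet> w = 0"
  and fr: "orthonormal_frame n (affine hull s) p e"
  using frame by (auto simp: hinge_frame_def orthonormal_frame_iff)

lemma p_hull_s: "p \<in> affine hull s"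
  using p_hull hull_mono[OF h_sub_s] by blast

lemma span_e: "span (e ` {..<n}) = tangent_space s"
proof -
  have "span (e ` {..<n}) = (\<lambda>x. x - p) ` (affine hull s)"
    by (rule orthonormal_frame_span[OF fr p_hull_s])
  also have "\<dots> = tangent_space s"
    unfolding affine_hull_eq_tangent_space[OF p_hull_s] by (simp add: image_image)
  finally show ?thesis .
qed

lemma e_in: "j < n \<Longrightarrow> e j \<in> tangent_space s"
  unfolding span_e[symmetric] by (rule span_base) simp

lemma e_inner: "i < n \<Longrightarrow> j < n \<Longrightarrow> e i \<bullet> e j = (if i = j then 1 else 0)"
  using fam by (simp add: orthonormal_family_def)

text \<open>\<open>hinge_frame\<close> requires \<open>e 0\<close> only to be orthogonal to the
  hinge, so its sign is free and both directions of crossing must be covered.\<close>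

lemma e0_cases: "e 0 = us \<or> e 0 = - us"
proof -
  let ?c = "e 0 \<bullet> us"
  let ?w = "e 0 - ?c *\<^sub>R us"
  have w: "?w \<in> tangent_space h" using us_dec e_in n_pos by simp
  have "?w \<bullet> ?w = e 0 \<bullet> ?w - ?c * (us \<bullet> ?w)" by (simp only: inner_diff_left[of _ _ ?w] inner_scaleR_left)
  also have "\<dots> = 0" using e0[OF w] us(4)[OF w] by simp
  finally have eq: "e 0 = ?c *\<^sub>R us" by simp
  have "norm (e 0) = 1" using e_inner[of 0 0] n_pos by (simp add: norm_eq_1)
  then have "\<bar>?c\<bar> = 1" using us(1) by (subst (asm) eq) simp
  then have "?c = 1 \<or> ?c = - 1" by linarith
  then show ?thesis using eq by auto
qed

lemma e_us: "0 < j \<Longrightarrow> j < n \<Longrightarrow> e j \<bullet> us = 0"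
  using e0_cases e_inner[of j 0] by auto

lemma e_in_h: "0 < j \<Longrightarrow> j < n \<Longrightarrow> e j \<in> tangent_space h"
  using us_dec[OF e_in, of j] e_us[of j] by simp

text \<open>Removing the first vector leaves a frame of the hinge with the same origin; the
  cross-sectional measure thereby becomes the volume of the hinge.\<close>

lemma frame_h: "orthonormal_frame (n - 1) (affine hull h) p (\<lambda>i. e (Suc i))"
proof -
  obtain m where m: "n = Suc m" using n_pos by (cases n) auto
  have "tangent_space h = span ((\<lambda>i. e (Suc i)) ` {..<m})"
  proof (intro subset_antisym subsetI)
    fix w assume w: "w \<in> tangent_space h"
    then have "w \<in> span (e ` {..<n})" unfolding span_e using tangent_space_mono[OF h_sub_s] by blast
    then have "w = (\<Sum>i<n. (w \<bullet> e i) *\<^sub>R e i)" using orthonormal_family_expand[OF fam] by simp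
    also have "\<dots> = (\<Sum>i<m. (w \<bullet> e (Suc i)) *\<^sub>R e (Suc i))"
      unfolding m sum.lessThan_Suc_shift using e0[OF w] by (simp add: inner_commute)
    also have "\<dots> \<in> span ((\<lambda>i. e (Suc i)) ` {..<m})"
      by (rule frame_sum_span[of _ "\<lambda>i. e (Suc i)"])
    finally show "w \<in> span ((\<lambda>i. e (Suc i)) ` {..<m})" .
  next
    fix w assume "w \<in> span ((\<lambda>i. e (Suc i)) ` {..<m})"
    moreover have "(\<lambda>i. e (Suc i)) ` {..<m} \<subseteq> tangent_space h" using e_in_h m by auto
    ultimately show "w \<in> tangent_space h" using span_minimal subspace_tangent_space by blast
  qed
  then show ?thesis
    unfolding orthonormal_frame_iff affine_hull_eq_tangent_space[OF p_hull] using e_inner m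
    by (simp add: orthonormal_family_def)
qed

definition foot :: "(nat \<Rightarrow> real) \<Rightarrow> real ^ 'm" where
  "foot y = p + (\<Sum>j \<in> {..<n} - {0}. y j *\<^sub>R e j)"

lemma foot_in: "foot y \<in> affine hull h"
  unfolding affine_hull_eq_tangent_space[OF p_hull] foot_def
  by (intro imageI subspace_sum subspace_tangent_space subspace_scale[OF subspace_tangent_space] e_in_h) auto

lemma foot_diff: "foot y - p \<in> tangent_space h"
  using foot_in affine_hull_diff_tangent_space[OF p_hull] by blast

text \<open>Folding sends nothing new onto the plane of the hinge: a point of the turned half would
  make a non-zero multiple of \<open>ut\<close> tangent to the hinge, although \<open>ut\<close> is
  orthogonal to it.\<close>

lemma fold_star_in_hull:
  assumes x: "x \<in> affine hull s" and f: "fold_star h s t p x \<in> affine hull h"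
  shows "(x - p) \<bullet> us = 0"
proof (rule ccontr)
  assume nz: "(x - p) \<bullet> us \<noteq> 0"
  have xs: "x - p \<in> tangent_space s" using x affine_hull_diff_tangent_space[OF p_hull_s] by blast
  have fh: "fold_star h s t p x - p \<in> tangent_space h" using f affine_hull_diff_tangent_space[OF p_hull] by blast
  show False
  proof (cases "(x - p) \<bullet> us \<ge> 0")
    case True
    then have "x - p \<in> tangent_space h" using fh by (simp add: fold_star_def Let_def)
    then show False using us(5) nz by blast
  next
    case False
    define r where "r = (x - p) \<bullet> us"
    have "x - p - r *\<^sub>R us \<in> tangent_space h" unfolding r_def by (rule us_dec[OF xs])
    moreover have "x - r *\<^sub>R us + \<bar>r\<bar> *\<^sub>R ut - p \<in> tangent_space h"
      using fh False by (simp add: fold_star_def Let_def r_def)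
    ultimately have "(x - r *\<^sub>R us + \<bar>r\<bar> *\<^sub>R ut - p) - (x - p - r *\<^sub>R us) \<in> tangent_space h"
      by (rule subspace_diff[OF subspace_tangent_space, rotated])
    then have "\<bar>r\<bar> *\<^sub>R ut \<in> tangent_space h" by (simp add: algebra_simps)
    from ut(3)[OF this] have "r = 0" using ut(2) by simp
    then show False using nz r_def by simp
  qed
qed

lemma frame_line_in: "i < n \<Longrightarrow> frame_line n p e i y r \<in> affine hull s"
  unfolding affine_hull_eq_tangent_space[OF p_hull_s] frame_line_def add.assoc
  by (intro imageI subspace_add[OF subspace_tangent_space] subspace_sum subspace_tangent_space
      subspace_scale[OF subspace_tangent_space] e_in) auto

lemma alpha_integral_parallel:
  assumes i: "0 < i" "i < n"
  shows "alpha_integral n N h s t p e i D = 0"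
proof -
  let ?g = "\<lambda>y r. fold_star h s t p (frame_line n p e i y r)"
  have "?g y r \<notin> rel_interior h" if y: "y 0 \<noteq> 0" for y r
  proof
    assume "?g y r \<in> rel_interior h"
    then have "?g y r \<in> affine hull h" using rel_interior_subset_affine_hull by blast
    then have 0: "(frame_line n p e i y r - p) \<bullet> us = 0"
      using fold_star_in_hull[OF frame_line_in[OF i(2)]] by blast
    \<comment> \<open>Along a line parallel to the hinge the height is constant, equal to
      \<open>y 0\<close> up to sign; the line can meet the hinge only if \<open>y 0 = 0\<close>, a
      null set of positions.\<close>
    have "(frame_line n p e i y r - p) \<bullet> us = (\<Sum>j\<in>{..<n}-{i}. y j * (e j \<bullet> us)) + r * (e i \<bullet> us)"
      by (simp add: frame_line_def inner_add_left inner_sum_left)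
    also have "(\<Sum>j\<in>{..<n}-{i}. y j * (e j \<bullet> us)) = (\<Sum>j\<in>{..<n}-{i}. if j = 0 then y 0 * (e 0 \<bullet> us) else 0)"
      using e_us by (intro sum.cong) auto
    also have "\<dots> = y 0 * (e 0 \<bullet> us)" using i n_pos by (simp add: sum.delta)
    finally show False using 0 e_us[OF i] e0_cases us(2) y by auto
  qed
  then have sc: "segment_curvature N h s t (?g y) I = 0" if "y 0 \<noteq> 0" for y I
    using that unfolding segment_curvature_def by auto
  have "AE y in Pi\<^sub>M ({..<n} - {i}) (\<lambda>_. lborel). y 0 \<noteq> (0::real)"
    using i by (intro AE_PiM_lborel_coordinate) auto
  then have "AE y in Pi\<^sub>M ({..<n} - {i}) (\<lambda>_. lborel).
     (\<Sum>\<^sub>\<infinity>I \<in> components {r. ?g y r \<in> D}. segment_curvature N h s t (?g y) I) = 0"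
    by eventually_elim (simp add: sc)
  then show ?thesis unfolding alpha_integral_def by (rule integral_eq_zero_AE)
qed

text \<open>After folding, the line consists of two rays from its foot along the two inward vectors.
  Which ray is the outgoing one depends on the sign of \<open>e 0\<close>.\<close>

lemma fold_frame_line:
  "\<exists>a b. ((a = us \<and> b = ut) \<or> (a = ut \<and> b = us)) \<and> (\<forall>y r.
     fold_star h s t p (frame_line n p e 0 y r) = foot y + (if 0 \<le> r then r *\<^sub>R a else (- r) *\<^sub>R b))"
proof -
  have line: "frame_line n p e 0 y r = foot y + r *\<^sub>R e 0" for y r by (simp add: frame_line_def foot_def)
  have inner: "(foot y + r *\<^sub>R e 0 - p) \<bullet> us = r * (e 0 \<bullet> us)" for y r
    using us(5)[OF foot_diff[of y]] by (simp add: inner_add_left inner_diff_left)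
  from e0_cases show ?thesis
  proof
    assume e0: "e 0 = us"
    show ?thesis
    proof (rule exI[of _ us], rule exI[of _ ut], intro conjI allI)
      fix y r
      show "fold_star h s t p (frame_line n p e 0 y r) = foot y + (if 0 \<le> r then r *\<^sub>R us else (- r) *\<^sub>R ut)"
        unfolding fold_star_def Let_def line inner by (auto simp: e0 us(2))
    qed simp
  next
    assume e0: "e 0 = - us"
    show ?thesis
    proof (rule exI[of _ ut], rule exI[of _ us], intro conjI allI)
      fix y r
      show "fold_star h s t p (frame_line n p e 0 y r) = foot y + (if 0 \<le> r then r *\<^sub>R ut else (- r) *\<^sub>R us)"
        unfolding fold_star_def Let_def line inner by (auto simp: e0 us(2))
    qed simp
  qed
qed

text \<open>The bent line touches the hinge only at parameter 0, so among the possibly infinitely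
  many segments in \<open>D\<close> only the component of 0 can have curvature.\<close>

lemma alpha_sum:
  "(\<Sum>\<^sub>\<infinity>I \<in> components {r. fold_star h s t p (frame_line n p e 0 y r) \<in> D}.
      segment_curvature N h s t (\<lambda>r. fold_star h s t p (frame_line n p e 0 y r)) I) =
   (if foot y \<in> rel_interior h \<inter> D then hinge_angle n K N h else 0)"
proof -
  obtain a b where ab: "(a = us \<and> b = ut) \<or> (a = ut \<and> b = us)"
    and fold: "\<And>y r. fold_star h s t p (frame_line n p e 0 y r) = foot y + (if 0 \<le> r then r *\<^sub>R a else (- r) *\<^sub>R b)"
    using fold_frame_line by blast
  define \<gamma> where "\<gamma> = (\<lambda>r::real. foot y + (if 0 \<le> r then r *\<^sub>R a else (- r) *\<^sub>R b))"
  have g: "(\<lambda>r. fold_star h s t p (frame_line n p e 0 y r)) = \<gamma>" by (simp add: fold \<gamma>_def fun_eq_iff)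
  define S where "S = {r. \<gamma> r \<in> D}"
  have S: "{r. fold_star h s t p (frame_line n p e 0 y r) \<in> D} = S"
    using g by (simp add: S_def fun_eq_iff)
  have \<gamma>0: "\<gamma> 0 = foot y" by (simp add: \<gamma>_def)
  have nab: "norm a = 1" "norm b = 1" using ab us(1) ut(1) by auto
  have hit: "r = 0" if "\<gamma> r \<in> rel_interior h" for r
  proof -
    have "\<gamma> r \<in> affine hull h" using that rel_interior_subset_affine_hull by blast
    then have "(frame_line n p e 0 y r - p) \<bullet> us = 0"
      using fold_star_in_hull[OF frame_line_in[of 0 y r]] n_pos fun_cong[OF g, of r] by simp
    then have "r * (e 0 \<bullet> us) = 0"
      using us(5)[OF foot_diff[of y]] by (simp add: frame_line_def foot_def inner_add_left inner_diff_left)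
    then show ?thesis using e0_cases us(2) by auto
  qed
  have zero: "segment_curvature N h s t \<gamma> I = 0" if "I \<in> components S" "0 \<notin> I \<or> foot y \<notin> rel_interior h \<inter> D" for I
  proof -
    have "I \<subseteq> S" using that in_components_subset by blast
    then have "\<gamma> ` I \<inter> rel_interior h = {}" using that(2) hit \<gamma>0 by (force simp: S_def)
    then show ?thesis by (simp add: segment_curvature_def)
  qed
  show ?thesis
  proof (cases "foot y \<in> rel_interior h \<inter> D")
    case False
    then have "(\<Sum>\<^sub>\<infinity>I \<in> components S. segment_curvature N h s t \<gamma> I) = 0"
      using zero by (intro infsum_0) auto
    then show ?thesis unfolding g S using False by auto
  next
    case True
    let ?q = "foot y"
    have "0 \<in> S" using True \<gamma>0 by (simp add: S_def)
    define I where "I = connected_component_set S 0"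
    have IS: "I \<in> components S" using \<open>0 \<in> S\<close> by (auto simp: I_def components_def)
    have I0: "0 \<in> I" using \<open>0 \<in> S\<close> by (simp add: I_def connected_component_refl_eq)
    have uniq: "J = I" if "J \<in> components S" "0 \<in> J" for J
      using components_nonoverlap[OF that(1) IS] that(2) I0 by blast
    have ngr: "norm (\<gamma> r - ?q) = \<bar>r\<bar>" for r using nab by (simp add: \<gamma>_def)
    \<comment> \<open>\<open>D\<close> is relatively open and the rays start inside \<open>s\<close>
      and \<open>t\<close>, so the component contains an interval around 0 and its ends lie on
      opposite sides of the bend.\<close>
    obtain O' where O: "open O'" "D = \<Union>K \<inter> O'" using D_open by (auto simp: openin_open)
    obtain d0 where d0: "d0 > 0" "ball ?q d0 \<subseteq> O'" using O True by (auto simp: open_contains_ball)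
    obtain d1 where d1: "d1 > 0" "\<And>r. 0 < r \<and> r < d1 \<Longrightarrow> ?q + r *\<^sub>R us \<in> rel_interior s"
      using s.facet_normal_enters[OF fn_s] True by blast
    obtain d2 where d2: "d2 > 0" "\<And>r. 0 < r \<and> r < d2 \<Longrightarrow> ?q + r *\<^sub>R ut \<in> rel_interior t"
      using t.facet_normal_enters[OF fn_t] True by blast
    define d where "d = min d0 (min d1 d2)"
    have d: "d > 0" using d0 d1 d2 by (simp add: d_def)
    have enter: "?q + r *\<^sub>R a \<in> \<Union>K" "?q + r *\<^sub>R b \<in> \<Union>K" if "0 < r" "r < d" for r
      using ab d1(2)[of r] d2(2)[of r] that in_K rel_interior_subset by (auto simp: d_def)
    have "{-d<..<d} \<subseteq> S"
    proof
      fix r assume r: "r \<in> {-d<..<d}"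
      have "dist ?q (\<gamma> r) < d0" using r ngr[of r] by (auto simp: dist_norm norm_minus_commute d_def)
      then have "\<gamma> r \<in> O'" using d0 by auto
      moreover have "\<gamma> r \<in> \<Union>K"
      proof (cases "r = 0")
        case True
        then show ?thesis using \<open>0 \<in> S\<close> O by (simp add: S_def)
      next
        case False
        then show ?thesis using enter(1)[of r] enter(2)[of "- r"] r by (auto simp: \<gamma>_def)
      qed
      ultimately show "r \<in> S" using O by (simp add: S_def)
    qed
    then have dI: "{-d<..<d} \<subseteq> I" unfolding I_def using d by (intro connected_component_maximal) auto
    \<comment> \<open>The star is bounded and the line has unit speed, so the component is bounded;
      only then are \<open>Inf\<close> and \<open>Sup\<close> its actual end points.\<close>
    obtain B where B: "\<And>x. x \<in> star K h \<Longrightarrow> norm x \<le> B" using bounded_star by (auto simp: bounded_iff)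
    have bI: "\<bar>r\<bar> \<le> B + norm ?q" if "r \<in> I" for r
    proof -
      have "\<gamma> r \<in> star K h" using that IS in_components_subset D_star by (force simp: S_def)
      then have "norm (\<gamma> r - ?q) \<le> B + norm ?q" using B norm_triangle_ineq4[of "\<gamma> r" ?q] by fastforce
      then show ?thesis using ngr by simp
    qed
    have bdd: "bdd_below I" "bdd_above I"
      using bI by (auto intro!: bdd_belowI[of _ "- (B + norm ?q)"] bdd_aboveI[of _ "B + norm ?q"] simp: abs_le_iff) (smt (verit))
    have "- d / 2 \<in> I" "d / 2 \<in> I" using dI d by auto
    then have IS0: "Inf I < 0" "0 < Sup I"
      using cInf_lower[OF _ bdd(1), of "- d / 2"] cSup_upper[OF _ bdd(2), of "d / 2"] d by auto
    \<comment> \<open>Parameter 0 hits the hinge, which selects the second branch; the tangents at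
      the ends are \<open>- b\<close> and \<open>a\<close>. Either assignment of the two inward
      vectors gives the hinge angle.\<close>
    have "segment_curvature N h s t \<gamma> I = signed_angle (N s + N t) (- b) a"
      using I0 True \<gamma>0 broken_line_tangents[OF IS0, of ?q a b]
      unfolding segment_curvature_def \<gamma>_def[symmetric] by (auto simp: image_iff disjoint_iff)
    also have "\<dots> = hinge_angle n K N h" using ab hinge_angle_eq hinge_angle_eq' by auto
    finally have val: "segment_curvature N h s t \<gamma> I = hinge_angle n K N h" .
    have "(\<Sum>\<^sub>\<infinity>J \<in> components S. segment_curvature N h s t \<gamma> J) = (\<Sum>\<^sub>\<infinity>J \<in> {I}. segment_curvature N h s t \<gamma> J)"
      using IS zero uniq by (intro infsum_cong_neutral) auto
    also have "\<dots> = hinge_angle n K N h" using val by simp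
    finally show ?thesis unfolding g S using True by simp
  qed
qed

text \<open>By \<open>alpha_sum\<close> the integrand is the hinge angle times the indicator of the
  feet in the piece, so only the measure of that set of feet remains.\<close>

lemma alpha_integral_orthogonal:
  "alpha_integral n N h s t p e 0 D =
     enn2real (flat_volume (n - 1) (affine hull h) (rel_interior h \<inter> D)) * hinge_angle n K N h"
proof -
  obtain m where m: "n = Suc m" using n_pos by (cases n) auto
  let ?J = "Pi\<^sub>M ({..<n} - {0}) (\<lambda>_. lborel :: real measure)"
  let ?I = "Pi\<^sub>M {..<m} (\<lambda>_. lborel :: real measure)"
  let ?f = "\<lambda>y::nat \<Rightarrow> real. \<lambda>i\<in>{..<m}. y (Suc i)"
  let ?X = "{y. foot y \<in> rel_interior h \<inter> D}"
  let ?Z = "{x \<in> {..<m} \<rightarrow>\<^sub>E UNIV. p + (\<Sum>i<m. x i *\<^sub>R e (Suc i)) \<in> rel_interior h \<inter> D}"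
  have bij: "bij_betw Suc {..<m} ({..<n} - {0})"
    unfolding m by (auto simp: bij_betw_def image_iff) (metis Suc_less_eq not0_implies_Suc lessThan_iff)
  have foot: "foot y = p + (\<Sum>i<m. ?f y i *\<^sub>R e (Suc i))" for y
    unfolding foot_def sum.reindex_bij_betw[OF bij, symmetric] by simp
  have meas: "?f \<in> measurable ?J ?I"
    unfolding m by (intro measurable_restrict measurable_component_singleton) auto
  have "(\<lambda>x. p + (\<Sum>i<m. x i *\<^sub>R e (Suc i))) \<in> borel_measurable ?I" by measurable
  then have "(\<lambda>x. p + (\<Sum>i<m. x i *\<^sub>R e (Suc i))) -` (rel_interior h \<inter> D) \<inter> space ?I \<in> sets ?I"
    using borel_openin_rel_interior[OF D_open in_K(1)] by (rule measurable_sets)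
  also have "(\<lambda>x. p + (\<Sum>i<m. x i *\<^sub>R e (Suc i))) -` (rel_interior h \<inter> D) \<inter> space ?I = ?Z"
    by (auto simp: space_PiM)
  finally have Z: "?Z \<in> sets ?I" .
  have "alpha_integral n N h s t p e 0 D = (\<integral>y. indicator ?X y * hinge_angle n K N h \<partial>?J)"
    unfolding alpha_integral_def alpha_sum by (intro Bochner_Integration.integral_cong) auto
  also have "\<dots> = measure ?J (?X \<inter> space ?J) * hinge_angle n K N h" by simp
  also have "?X \<inter> space ?J = ?f -` ?Z \<inter> space ?J" unfolding foot by auto
  also have "measure ?J \<dots> = measure (distr ?J ?I ?f) ?Z"
    using meas Z by (rule measure_distr[symmetric])
  also have "\<dots> = enn2real (flat_volume (n - 1) (affine hull h) (rel_interior h \<inter> D))"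
    unfolding PiM_lborel_reindex[OF bij finite_lessThan] flat_volume_eq[OF frame_h] measure_def
    by (simp add: m)
  finally show ?thesis .
qed

lemma piece_integral:
  "(\<Sum>i<n. alpha_integral n N h s t p e i D) =
     enn2real (flat_volume (n - 1) (affine hull h) (rel_interior h \<inter> D)) * hinge_angle n K N h"
proof -
  have "(\<Sum>i<n. alpha_integral n N h s t p e i D) = (\<Sum>i<n. if i = 0 then alpha_integral n N h s t p e 0 D else 0)"
    using alpha_integral_parallel by (intro sum.cong) auto
  also have "\<dots> = alpha_integral n N h s t p e 0 D" using n_pos by (simp add: sum.delta)
  finally show ?thesis using alpha_integral_orthogonal by simp
qed

end

section \<open>Decompositions of a vertex region\<close>

lemma orthonormal_family_exists:
  fixes T :: "'a::euclidean_space set"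
  assumes "subspace T" "dim T = k"
  obtains e where "orthonormal_family k e" "span (e ` {..<k}) = T"
proof -
  obtain B where B: "pairwise orthogonal B" "\<And>x. x \<in> B \<Longrightarrow> norm x = 1" "independent B" "card B = k" "span B = T"
    using orthonormal_basis_subspace[OF assms(1)] assms(2) by metis
  have "finite B" using B(3) by (rule independent_imp_finite)
  then obtain e where e: "bij_betw e {0..<k} B" using ex_bij_betw_nat_finite B(4) by blast
  then have im: "e ` {..<k} = B" and inj: "inj_on e {..<k}" by (auto simp: bij_betw_def atLeast0LessThan)
  have "e i \<bullet> e j = (if i = j then 1 else 0)" if "i < k" "j < k" for i j
  proof (cases "i = j")
    case True
    then show ?thesis using B(2)[of "e i"] im that by (auto simp: norm_eq_1)
  next
    case False
    then have "e i \<noteq> e j" "e i \<in> B" "e j \<in> B" using inj im that by (auto simp: inj_on_def)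
    then show ?thesis using B(1) False by (auto simp: pairwise_def orthogonal_def)
  qed
  then have "orthonormal_family k e" by (simp add: orthonormal_family_def)
  then show ?thesis using that im B(5) by simp
qed

lemma simplex_frame_exists:
  assumes "int k simplex s"
  obtains p e where "orthonormal_frame k (affine hull s) p e"
proof -
  obtain p where p: "p \<in> s" using simplex_nonempty[OF assms] by blast
  have ph: "p \<in> affine hull s" using p by (rule hull_inc)
  have "int (dim (tangent_space s)) = aff_dim s"
    using aff_dim_eq_dim_subtract[of p s] ph by (simp add: tangent_space_eq_span[OF p])
  then have "dim (tangent_space s) = k" using aff_dim_simplex[OF assms] by simp
  then obtain e where "orthonormal_family k e" "span (e ` {..<k}) = tangent_space s"
    using orthonormal_family_exists[OF subspace_tangent_space] by blast
  then show ?thesis using that[of p e] affine_hull_eq_tangent_space[OF ph] by (simp add: orthonormal_frame_iff)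
qed

text \<open>A frame of the affine hull has to exist before the definite description can be
  evaluated.\<close>

lemma flat_volume_empty:
  assumes "int k simplex s"
  shows "flat_volume k (affine hull s) {} = 0"
proof -
  obtain p e where "orthonormal_frame k (affine hull s) p e" using simplex_frame_exists[OF assms] by blast
  then show ?thesis by (simp add: flat_volume_eq)
qed

text \<open>In a fixed frame the volume is a Borel measure on the ambient space. Boundedness of
  \<open>B\<close> keeps its values finite, as \<open>enn2real\<close> is additive only
  there.\<close>

lemma flat_volume_additive:
  fixes A B :: "'a::euclidean_space set"
  assumes s: "int k simplex s" and B: "bounded B"
    and D: "finite \<D>" "disjoint \<D>" "\<And>D. D \<in> \<D> \<Longrightarrow> B \<inter> D \<in> sets borel" "\<Union>\<D> \<subseteq> A"
    and A: "B \<inter> A \<in> sets borel" and null: "flat_volume k (affine hull s) (B \<inter> (A - \<Union>\<D>)) = 0"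
  shows "enn2real (flat_volume k (affine hull s) (B \<inter> A)) = (\<Sum>D\<in>\<D>. enn2real (flat_volume k (affine hull s) (B \<inter> D)))"
proof -
  let ?M = "Pi\<^sub>M {..<k} (\<lambda>_. lborel :: real measure)"
  obtain p e where fr: "orthonormal_frame k (affine hull s) p e" using simplex_frame_exists[OF s] by blast
  then have fam: "orthonormal_family k e" by (simp add: orthonormal_frame_iff)
  let ?F = "\<lambda>x. p + (\<Sum>i<k. x i *\<^sub>R e i)"
  define \<nu> where "\<nu> = distr ?M borel ?F"
  have F: "?F \<in> borel_measurable ?M" by measurable
  have sets_\<nu>: "sets \<nu> = sets borel" by (simp add: \<nu>_def)
  have vol: "flat_volume k (affine hull s) X = emeasure \<nu> X" if "X \<in> sets borel" for X
    unfolding \<nu>_def flat_volume_eq[OF fr] using that F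
    by (subst emeasure_distr) (auto simp: space_PiM intro!: arg_cong[where f="emeasure _"])
  obtain C where C: "\<And>x. x \<in> B \<Longrightarrow> norm x \<le> C" using B by (auto simp: bounded_iff)
  define c where "c = C + norm p"
  have fin: "emeasure \<nu> X < \<infinity>" if X: "X \<in> sets borel" "X \<subseteq> B" for X
  proof -
    \<comment> \<open>Coordinates do not exceed the distance from the origin \<open>p\<close> of the
      frame, so the coordinate set lies in a cube of half side \<open>c\<close>.\<close>
    have "?F -` X \<inter> space ?M \<subseteq> Pi\<^sub>E {..<k} (\<lambda>_. {-c..c})"
    proof
      fix x assume x: "x \<in> ?F -` X \<inter> space ?M"
      have "x i \<in> {-c..c}" if "i < k" for i
      proof -
        have "\<bar>x i\<bar> = sqrt ((x i)\<^sup>2)" by simp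
        also have "\<dots> \<le> sqrt (\<Sum>j<k. (x j)\<^sup>2)" using that by (intro real_sqrt_le_mono member_le_sum) auto
        also have "\<dots> = norm (?F x - p)" by (simp add: orthonormal_family_norm[OF fam])
        also have "\<dots> \<le> norm (?F x) + norm p" by (rule norm_triangle_ineq4)
        also have "\<dots> \<le> c" unfolding c_def using x X C by force
        finally show ?thesis by (auto simp: abs_le_iff)
      qed
      then show "x \<in> Pi\<^sub>E {..<k} (\<lambda>_. {-c..c})" using x by (auto simp: space_PiM PiE_iff)
    qed
    then have "emeasure ?M (?F -` X \<inter> space ?M) \<le> emeasure ?M (Pi\<^sub>E {..<k} (\<lambda>_. {-c..c}))"
      by (intro emeasure_mono) (auto intro!: sets_PiM_I_finite)
    also have "\<dots> = (\<Prod>i<k. emeasure lborel {-c..c})" by (subst lborel_product.emeasure_PiM) auto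
    also have "\<dots> < \<infinity>" by (simp add: power_less_top_ennreal emeasure_lborel_Icc_eq)
    finally show ?thesis unfolding \<nu>_def using X F by (subst emeasure_distr) auto
  qed
  have U: "B \<inter> \<Union>\<D> \<in> sets borel"
  proof -
    have "(\<Union>D\<in>\<D>. B \<inter> D) \<in> sets borel" using D by (intro sets.finite_UN) auto
    then show ?thesis by (simp only: Int_Union)
  qed
  have AU: "B \<inter> (A - \<Union>\<D>) \<in> sets borel"
  proof -
    have "B \<inter> A - B \<inter> \<Union>\<D> \<in> sets borel" using A U by (rule sets.Diff)
    also have "B \<inter> A - B \<inter> \<Union>\<D> = B \<inter> (A - \<Union>\<D>)" by blast
    finally show ?thesis .
  qed
  have "B \<inter> A = (B \<inter> \<Union>\<D>) \<union> (B \<inter> (A - \<Union>\<D>))" using D(4) by blast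
  then have "emeasure \<nu> (B \<inter> A) = emeasure \<nu> (B \<inter> \<Union>\<D>) + emeasure \<nu> (B \<inter> (A - \<Union>\<D>))"
    using U AU by (subst plus_emeasure) (auto simp: sets_\<nu>)
  also have "emeasure \<nu> (B \<inter> (A - \<Union>\<D>)) = 0" using null unfolding vol[OF AU] .
  also have "emeasure \<nu> (B \<inter> \<Union>\<D>) + 0 = emeasure \<nu> (\<Union>D\<in>\<D>. B \<inter> D)"
    unfolding Int_Union by (rule add_0_right)
  also have "\<dots> = (\<Sum>D\<in>\<D>. emeasure \<nu> (B \<inter> D))"
  proof (rule sum_emeasure[symmetric])
    show "(\<lambda>D. B \<inter> D) ` \<D> \<subseteq> sets \<nu>" using D(3) by (auto simp: sets_\<nu>)
    show "disjoint_family_on (\<lambda>D. B \<inter> D) \<D>"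
      using D(2) by (auto simp: disjoint_family_on_def disjoint_def)
  qed (rule D(1))
  finally have "emeasure \<nu> (B \<inter> A) = (\<Sum>D\<in>\<D>. emeasure \<nu> (B \<inter> D))" .
  then have "enn2real (emeasure \<nu> (B \<inter> A)) = (\<Sum>D\<in>\<D>. enn2real (emeasure \<nu> (B \<inter> D)))"
    using fin[OF D(3)] by (simp add: enn2real_sum)
  then show ?thesis using vol A D(3) by simp
qed

text \<open>Integrate first along a coordinate with non-zero coefficient: each such line contains at
  most one zero. If all coefficients vanish, the constant is non-zero and there are no
  zeros.\<close>

lemma affine_zero_set_null:
  fixes c :: "'i \<Rightarrow> real"
  assumes I: "finite I" and nz: "a \<noteq> 0 \<or> (\<exists>i\<in>I. c i \<noteq> 0)"
  shows "{x \<in> space (Pi\<^sub>M I (\<lambda>_. lborel)). a + (\<Sum>i\<in>I. x i * c i) = 0} \<in> null_sets (Pi\<^sub>M I (\<lambda>_. lborel))"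
proof (cases "\<exists>i\<in>I. c i \<noteq> 0")
  case False
  then have "a \<noteq> 0" "\<And>x. (\<Sum>i\<in>I. x i * c i) = 0" using nz by auto
  then show ?thesis by simp
next
  case True
  then obtain i where i: "i \<in> I" "c i \<noteq> 0" by blast
  define J where "J = I - {i}"
  have J: "finite J" "i \<notin> J" "I = insert i J" using I i by (auto simp: J_def)
  let ?M = "Pi\<^sub>M I (\<lambda>_. lborel :: real measure)"
  let ?Z = "{x \<in> space ?M. a + (\<Sum>i\<in>I. x i * c i) = 0}"
  have Z: "?Z \<in> sets ?M" by measurable
  have "emeasure ?M ?Z = (\<integral>\<^sup>+x. indicator ?Z x \<partial>?M)" using Z by simp
  also have "\<dots> = (\<integral>\<^sup>+x. (\<integral>\<^sup>+y. indicator ?Z (x(i := y)) \<partial>lborel) \<partial>Pi\<^sub>M J (\<lambda>_. lborel))"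
    using Z unfolding J(3) by (intro lborel_product.product_nn_integral_insert[OF J(1,2)]) auto
  also have "\<dots> = (\<integral>\<^sup>+x. 0 \<partial>Pi\<^sub>M J (\<lambda>_. lborel :: real measure))"
  proof (rule nn_integral_cong)
    fix x
    define y0 where "y0 = - (a + (\<Sum>j\<in>J. x j * c j)) / c i"
    have "(\<Sum>j\<in>I. (x(i := y)) j * c j) = y * c i + (\<Sum>j\<in>J. x j * c j)" for y
      unfolding J(3) sum.insert[OF J(1,2)] using J(2) by (auto intro!: sum.cong)
    then have "x(i := y) \<in> ?Z \<Longrightarrow> y = y0" for y
      using i(2) by (simp add: y0_def field_simps)
    then have "(\<integral>\<^sup>+y. indicator ?Z (x(i := y)) \<partial>lborel) \<le> (\<integral>\<^sup>+y. indicator {y0} y \<partial>lborel)"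
      by (intro nn_integral_mono) (auto simp: indicator_def)
    then show "(\<integral>\<^sup>+y. indicator ?Z (x(i := y)) \<partial>lborel) = 0" by simp
  qed
  finally show ?thesis using Z by auto
qed

section \<open>Frames and volumes of the hinges\<close>

context pf_submanifold
begin

lemma hinge_simplex: "h \<in> hinges n K \<Longrightarrow> int (n - 1) simplex h"
  and hinge_in_K: "h \<in> hinges n K \<Longrightarrow> h \<in> K"
  by (auto simp: hinges_def k_simplices_def)

lemma hinge_subset_eq: "h \<in> hinges n K \<Longrightarrow> h' \<in> hinges n K \<Longrightarrow> h \<subseteq> h' \<Longrightarrow> h = h'"
  unfolding hinges_def by (rule k_simplices_subset_eq)

text \<open>The inward normal is put in front of a frame of the hinge; the two together span the
  directions of \<open>s\<close>.\<close>

lemma hinge_frame_exists: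
  assumes "hinge_pair n K h s t"
  obtains p e where "hinge_frame n h s p e"
proof -
  interpret hinge K n N h s t by unfold_locales (rule assms)
  obtain m where m: "n = Suc m" using n_pos by (cases n) auto
  obtain p e where fr: "orthonormal_frame m (affine hull h) p e"
    using simplex_frame_exists[OF s.h_simplex] m by auto
  let ?u = "inward h s"
  have u: "facet_normal h s ?u" by (rule s.facet_normal_inward)
  have p: "p \<in> affine hull h" by (rule orthonormal_frame_origin[OF fr])
  have ps: "p \<in> affine hull s" using p hull_mono[OF h_sub_s] by blast
  have fam: "orthonormal_family m e" using fr by (simp add: orthonormal_frame_iff)
  have sp: "span (e ` {..<m}) = tangent_space h"
    using orthonormal_frame_span[OF fr p] unfolding affine_hull_eq_tangent_space[OF p] by (simp add: image_image)
  have eh: "e i \<in> tangent_space h" if "i < m" for i unfolding sp[symmetric] using that by (intro span_base) auto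
  define e' where "e' i = (case i of 0 \<Rightarrow> ?u | Suc j \<Rightarrow> e j)" for i
  have img: "e' ` {..<n} = insert ?u (e ` {..<m})"
    unfolding m lessThan_Suc_eq_insert_0 by (simp add: e'_def image_image)
  have "e' i \<bullet> e' j = (if i = j then 1 else 0)" if "i < n" "j < n" for i j
    using that u eh fam unfolding m facet_normal_def orthonormal_family_def
    by (auto simp: e'_def norm_eq_1 inner_commute split: nat.splits)
  then have fam': "orthonormal_family n e'" by (simp add: orthonormal_family_def)
  have "span (e' ` {..<n}) = tangent_space s"
  proof (intro subset_antisym subsetI)
    have "insert ?u (e ` {..<m}) \<subseteq> tangent_space s"
      using u eh tangent_space_mono[OF h_sub_s] by (auto simp: facet_normal_def)
    then show "w \<in> tangent_space s" if "w \<in> span (e' ` {..<n})" for w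
      using span_minimal[OF _ subspace_tangent_space] that unfolding img by blast
  next
    fix w assume "w \<in> tangent_space s"
    then have "w - (w \<bullet> ?u) *\<^sub>R ?u \<in> span (e ` {..<m})" using u unfolding sp by (simp add: facet_normal_def)
    then show "w \<in> span (e' ` {..<n})" unfolding img span_insert by blast
  qed
  then have "orthonormal_frame n (affine hull s) p e'"
    unfolding orthonormal_frame_iff affine_hull_eq_tangent_space[OF ps] using fam' by simp
  moreover have "\<forall>w\<in>tangent_space h. e' 0 \<bullet> w = 0" using u by (simp add: e'_def facet_normal_def)
  ultimately show ?thesis using that p by (auto simp: hinge_frame_def)
qed

definition hinge_volume :: "(real ^ 'm) set \<Rightarrow> (real ^ 'm) set \<Rightarrow> real" where
  "hinge_volume h A = enn2real (flat_volume (n - 1) (affine hull h) (rel_interior h \<inter> A))"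

lemma hinge_volume_eq_0: "h \<in> hinges n K \<Longrightarrow> rel_interior h \<inter> A = {} \<Longrightarrow> hinge_volume h A = 0"
  by (simp add: hinge_volume_def flat_volume_empty[OF hinge_simplex] del: One_nat_def)

text \<open>A piece in the star of \<open>h\<close> has no volume in any other hinge, so its value
  can be written as a sum over all hinges.\<close>

lemma star_hinge_disjoint:
  assumes "h \<in> hinges n K" "h' \<in> hinges n K" "h \<noteq> h'"
  shows "rel_interior h' \<inter> star K h = {}"
proof (rule ccontr)
  assume "rel_interior h' \<inter> star K h \<noteq> {}"
  then obtain x f where x: "x \<in> rel_interior h'" "f \<in> K" "h \<subseteq> f" "x \<in> rel_interior f" by (auto simp: star_iff)
  then have "f = h'" using rel_interior_unique hinge_in_K[OF assms(2)] by blast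
  then show False using hinge_subset_eq[OF assms(1,2)] x(3) assms(3) by blast
qed

lemma rel_interior_hinge_disjoint_top:
  assumes "h \<in> hinges n K" "u \<in> k_simplices K n"
  shows "rel_interior h \<inter> rel_interior u = {}"
proof (rule ccontr)
  assume "rel_interior h \<inter> rel_interior u \<noteq> {}"
  then have "h = u" using rel_interior_unique[of h u] hinge_in_K[OF assms(1)] assms(2) by (auto simp: k_simplices_def)
  then have "int (n - 1) = int n"
    using aff_dim_simplex[OF hinge_simplex[OF assms(1)]] aff_dim_simplex[of "int n" u] assms(2)
    by (simp add: k_simplices_def)
  then show False using n_pos by simp
qed

end

section \<open>Uniqueness of the integral over a vertex region\<close>

locale vertex_region = pf_submanifold K n N for K :: "(real ^ 'm) set set" and n N +
  fixes V :: "real ^ 'm \<Rightarrow> (real ^ 'm) set" and v :: "real ^ 'm"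
  assumes dual: "dual_tessellation n K V" and v: "v \<in> vertices K"
begin

abbreviation "H \<equiv> hinges_in_star n K v"

lemma H_hinges: "h \<in> H \<Longrightarrow> h \<in> hinges n K"
  by (simp add: hinges_in_star_def)

lemma V_open: "openin (top_of_set (\<Union>K)) (V v)"
  using dual v by (simp add: dual_tessellation_def)

lemma V_hinge: "h \<in> hinges n K \<Longrightarrow> h \<notin> H \<Longrightarrow> rel_interior h \<inter> V v = {}"
  using dual v unfolding dual_tessellation_def by blast

text \<open>An open hinge in the star of \<open>v\<close> is the carrier of its points, so the
  closed hinge contains \<open>v\<close>; local finiteness at \<open>v\<close> then bounds the
  number of hinges.\<close>

lemma finite_H: "finite H"
proof -
  have "{v} \<in> K" using v by (simp add: vertices_def)
  then obtain U where U: "v \<in> U" "finite {s \<in> K. s \<inter> U \<noteq> {}}" using locally_finite[of v] by blast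
  have "h \<in> {s \<in> K. s \<inter> U \<noteq> {}}" if "h \<in> H" for h
  proof -
    have hK: "h \<in> K" using H_hinges hinge_in_K that by blast
    have "rel_interior h \<noteq> {}"
      using hinge_simplex[OF H_hinges[OF that]] simplex_nonempty convex_simplex rel_interior_eq_empty by blast
    then obtain x where x: "x \<in> rel_interior h" by blast
    then have "x \<in> star K {v}" using that by (auto simp: hinges_in_star_def)
    then obtain f where f: "f \<in> K" "{v} \<subseteq> f" "x \<in> rel_interior f" by (auto simp: star_iff)
    then have "f = h" using rel_interior_unique hK x by blast
    then show ?thesis using hK f U(1) by blast
  qed
  then show ?thesis using U(2) by (meson finite_subset subsetI)
qed

text \<open>Summing over all hinges at \<open>v\<close> gives one formula for both kinds of piece,
  in which neither the chosen hinge nor the frame occurs.\<close>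

lemma piece_value:
  assumes I: "has_piece_integral n K N D I" and D: "D \<subseteq> V v" "openin (top_of_set (\<Union>K)) D"
  shows "I = (\<Sum>h\<in>H. hinge_volume h D * hinge_angle n K N h)"
proof -
  consider h s t p e where "hinge_pair n K h s t" "hinge_frame n h s p e" "D \<subseteq> star K h"
      "I = (\<Sum>i<n. alpha_integral n N h s t p e i D)"
    | "\<forall>h \<in> hinges n K. D \<inter> rel_interior h = {}" "I = 0"
    using I unfolding has_piece_integral_def by blast
  then show ?thesis
  proof cases
    case 1
    interpret hinge_piece K n N h s t p e D using 1 D by unfold_locales
    have "I = hinge_volume h D * hinge_angle n K N h"
      using 1(4) piece_integral by (simp add: hinge_volume_def)
    \<comment> \<open>If \<open>h\<close> is not in the star of \<open>v\<close>, the vertex region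
      misses it and its term is 0, so its absence from the sum does no harm.\<close>
    also have "\<dots> = (\<Sum>h'\<in>H. if h' = h then hinge_volume h D * hinge_angle n K N h else 0)"
      using finite_H V_hinge[OF h_hinge] D(1) hinge_volume_eq_0[OF h_hinge, of D] by (auto simp: sum.delta)
    also have "\<dots> = (\<Sum>h\<in>H. hinge_volume h D * hinge_angle n K N h)"
    proof (rule sum.cong[OF refl])
      fix h' assume "h' \<in> H"
      then have h': "h' \<in> hinges n K" by (rule H_hinges)
      show "(if h' = h then hinge_volume h D * hinge_angle n K N h else 0) = hinge_volume h' D * hinge_angle n K N h'"
        using star_hinge_disjoint[OF h_hinge h'] hinge_volume_eq_0[OF h', of D] D_star by auto
    qed
    finally show ?thesis .
  next
    case 2
    then show ?thesis using hinge_volume_eq_0 H_hinges by (simp add: Int_commute)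
  qed
qed

text \<open>For each hinge the pieces cover its part in the region up to a null set, so their hinge
  volumes add up to that of the region; exchanging the two finite sums does the rest.\<close>

lemma integral_value:
  assumes "has_mean_curvature_integral n K N (V v) I"
  shows "I = (\<Sum>h\<in>H. hinge_volume h (V v) * hinge_angle n K N h)"
proof -
  obtain \<D> c where fin: "finite \<D>" and dis: "disjoint \<D>" and sub: "\<Union>\<D> \<subseteq> V v"
    and pieces: "\<And>D. D \<in> \<D> \<Longrightarrow> openin (top_of_set (\<Union>K)) D \<and> has_piece_integral n K N D (c D)"
    and null: "\<And>h. h \<in> hinges n K \<Longrightarrow> flat_volume (n - 1) (affine hull h) (rel_interior h \<inter> (V v - \<Union>\<D>)) = 0"
    and I: "I = (\<Sum>D\<in>\<D>. c D)"
    using assms unfolding has_mean_curvature_integral_def by metis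
  have vol: "hinge_volume h (V v) = (\<Sum>D\<in>\<D>. hinge_volume h D)" if h: "h \<in> hinges n K" for h
    unfolding hinge_volume_def
  proof (rule flat_volume_additive[OF hinge_simplex[OF h] _ fin dis _ sub _ null[OF h]])
    show "bounded (rel_interior h)"
      using compact_simplex[OF hinge_simplex[OF h]] compact_imp_bounded bounded_subset rel_interior_subset by metis
    show "rel_interior h \<inter> D \<in> sets borel" if "D \<in> \<D>" for D
      using borel_openin_rel_interior pieces[OF that] hinge_in_K[OF h] by blast
    show "rel_interior h \<inter> V v \<in> sets borel"
      by (rule borel_openin_rel_interior[OF V_open hinge_in_K[OF h]])
  qed
  have "I = (\<Sum>D\<in>\<D>. \<Sum>h\<in>H. hinge_volume h D * hinge_angle n K N h)"
    unfolding I
  proof (rule sum.cong[OF refl])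
    fix D assume "D \<in> \<D>"
    then show "c D = (\<Sum>h\<in>H. hinge_volume h D * hinge_angle n K N h)"
      using pieces sub by (intro piece_value) blast+
  qed
  also have "\<dots> = (\<Sum>h\<in>H. (\<Sum>D\<in>\<D>. hinge_volume h D) * hinge_angle n K N h)"
    by (subst sum.swap) (simp add: sum_distrib_right)
  also have "\<dots> = (\<Sum>h\<in>H. hinge_volume h (V v) * hinge_angle n K N h)"
    using vol H_hinges by (intro sum.cong) auto
  finally show ?thesis .
qed

section \<open>Bisector sectors and existence of a decomposition\<close>

definition height :: "(real ^ 'm) set \<Rightarrow> (real ^ 'm) set \<Rightarrow> real ^ 'm \<Rightarrow> real" where
  "height u h x = (x - (SOME p. p \<in> h)) \<bullet> inward h u"

lemma
  assumes h: "h \<in> hinges n K" and u: "u \<in> k_simplices K n" "h \<subseteq> u"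
  shows height_nonneg: "x \<in> u \<Longrightarrow> 0 \<le> height u h x"
    and height_eq_0_imp: "x \<in> u \<Longrightarrow> height u h x = 0 \<Longrightarrow> x \<in> h"
    and height_facet: "x \<in> h \<Longrightarrow> height u h x = 0"
proof -
  interpret simplex_facet n h u using h u by (rule simplex_facetI)
  \<comment> \<open>The base point in \<open>height\<close> is an arbitrary point of
    \<open>h\<close>. As the inward vector is orthogonal to \<open>h\<close>, another point would
    give the same height.\<close>
  have p: "(SOME p. p \<in> h) \<in> h" using simplex_nonempty[OF h_simplex] by (simp add: some_in_eq)
  have fn: "facet_normal h u (inward h u)" by (rule facet_normal_inward)
  show "x \<in> u \<Longrightarrow> 0 \<le> height u h x" "x \<in> u \<Longrightarrow> height u h x = 0 \<Longrightarrow> x \<in> h"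
    using fn hull_inc[OF p, of affine] unfolding facet_normal_def height_def by blast+
  show "height u h x = 0" if x: "x \<in> h"
  proof -
    have "inward h u \<bullet> (x - (SOME p. p \<in> h)) = 0"
      using fn tangent_space_diff[OF x p] unfolding facet_normal_def by blast
    then show ?thesis unfolding height_def by (subst inner_commute)
  qed
qed

text \<open>The part of the star of \<open>h\<close> in which \<open>h\<close> is the nearest of the facets through \<open>v\<close>.\<close>
definition sector :: "(real ^ 'm) set \<Rightarrow> (real ^ 'm) set" where
  "sector h = star K h - (\<Union>h' \<in> H - {h}. \<Union>u \<in> {u \<in> k_simplices K n. h \<subseteq> u \<and> h' \<subseteq> u}.
     {x \<in> u. height u h' x \<le> height u h x})"

text \<open>Ties are removed as well, so the removed sets are closed; there are finitely many of
  them because \<open>H\<close> is finite and a hinge lies in only two n-simplices.\<close>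

lemma sector_open:
  assumes "h \<in> H"
  shows "openin (top_of_set (\<Union>K)) (sector h)"
proof -
  let ?U = "\<lambda>h'. {u \<in> k_simplices K n. h \<subseteq> u \<and> h' \<subseteq> u}"
  let ?C = "\<Union>h' \<in> H - {h}. \<Union>u \<in> ?U h'. {x \<in> u. height u h' x \<le> height u h x}"
  obtain s t where st: "hinge_pair n K h s t" using hinge_pair_exists[OF H_hinges[OF assms]] by blast
  have "?U h' \<subseteq> {s, t}" for h' using st unfolding hinge_pair_def by blast
  then have finU: "finite (?U h')" for h' by (rule finite_subset) simp
  have "closed {x \<in> u. height u h' x \<le> height u h x}" if "u \<in> ?U h'" for u h'
  proof -
    have "closed u" using that K_closed by (simp add: k_simplices_def)
    moreover have "closed {x. height u h' x \<le> height u h x}"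
      unfolding height_def by (intro closed_Collect_le continuous_intros)
    ultimately show ?thesis by (simp add: Collect_conj_eq closed_Int)
  qed
  then have clC: "closed ?C" using finite_H finU by (intro closed_UN ballI) auto
  obtain W where W: "open W" "star K h = \<Union>K \<inter> W" using star_open[of h] by (auto simp: openin_open)
  have "sector h = \<Union>K \<inter> (W - ?C)" unfolding sector_def W(2) by blast
  then show ?thesis using open_Diff[OF W(1) clC] by (auto simp: openin_open)
qed

text \<open>A common point lies in an n-simplex containing both hinges, and there each of them would
  have to be strictly nearer than the other.\<close>

lemma sector_disjoint:
  assumes h: "h \<in> H" "h' \<in> H" "h \<noteq> h'"
  shows "sector h \<inter> sector h' = {}"
proof (rule ccontr)
  assume "sector h \<inter> sector h' \<noteq> {}"
  then obtain x where x: "x \<in> sector h" "x \<in> sector h'" by blast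
  then have "x \<in> star K h" "x \<in> star K h'" by (auto simp: sector_def)
  then obtain f f' where f: "f \<in> K" "h \<subseteq> f" "x \<in> rel_interior f" and f': "f' \<in> K" "h' \<subseteq> f'" "x \<in> rel_interior f'"
    by (auto simp: star_iff)
  have "f' = f" using rel_interior_unique f f' by blast
  obtain u where u: "u \<in> k_simplices K n" "f \<subseteq> u" using in_top_simplex[OF f(1)] by blast
  have xu: "x \<in> u" "h \<subseteq> u" "h' \<subseteq> u" using f f' u \<open>f' = f\<close> rel_interior_subset by blast+
  have "\<not> height u h' x \<le> height u h x"
    using x(1) h u xu unfolding sector_def by blast
  moreover have "\<not> height u h x \<le> height u h' x"
    using x(2) h u xu unfolding sector_def by blast
  ultimately show False by linarith
qed

text \<open>On the open hinge its own height is 0, and a second facet of height 0 would contain the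
  whole hinge. Thus no bisector cuts into a hinge, where the curvature sits.\<close>

lemma rel_interior_subset_sector:
  assumes h: "h \<in> H"
  shows "rel_interior h \<subseteq> sector h"
proof
  fix x assume x: "x \<in> rel_interior h"
  have hh: "h \<in> hinges n K" using h by (rule H_hinges)
  have "x \<in> star K h" using x hinge_in_K[OF hh] by (auto simp: star_iff)
  moreover have "\<not> height u h' x \<le> height u h x"
    if h': "h' \<in> H" "h' \<noteq> h" and u: "u \<in> k_simplices K n" "h \<subseteq> u" "h' \<subseteq> u" for h' u
  proof
    assume le: "height u h' x \<le> height u h x"
    have hh': "h' \<in> hinges n K" using h'(1) by (rule H_hinges)
    have xh: "x \<in> h" using x rel_interior_subset by blast
    then have "height u h' x = 0"
      using le height_facet[OF hh u(1,2)] height_nonneg[OF hh' u(1,3), of x] u(2) by auto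
    then have "x \<in> h'" using height_eq_0_imp[OF hh' u(1,3)] xh u(2) by blast
    then have "h \<subseteq> h'" using rel_interior_imp_subset hinge_in_K hh hh' x by blast
    then show False using hinge_subset_eq[OF hh hh'] h'(2) by blast
  qed
  ultimately show "x \<in> sector h" unfolding sector_def by blast
qed

text \<open>The difference of two heights is affine in the coordinates. It is not identically zero:
  on the open facet \<open>h\<close> the first height vanishes and the second does not.\<close>

lemma height_tie_null:
  assumes h: "h \<in> H" "h' \<in> H" "h \<noteq> h'" and u: "u \<in> k_simplices K n" "h \<subseteq> u" "h' \<subseteq> u"
    and fr: "orthonormal_frame n (affine hull u) p e"
  shows "{x \<in> space (Pi\<^sub>M {..<n} (\<lambda>_. lborel)).
      height u h (p + (\<Sum>i<n. x i *\<^sub>R e i)) = height u h' (p + (\<Sum>i<n. x i *\<^sub>R e i))}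
    \<in> null_sets (Pi\<^sub>M {..<n} (\<lambda>_. lborel))"
proof -
  have hh: "h \<in> hinges n K" "h' \<in> hinges n K" using h H_hinges by auto
  define a where "a = height u h p - height u h' p"
  define c where "c i = e i \<bullet> (inward h u - inward h' u)" for i
  have diff: "height u h (p + (\<Sum>i<n. x i *\<^sub>R e i)) - height u h' (p + (\<Sum>i<n. x i *\<^sub>R e i)) = a + (\<Sum>i<n. x i * c i)" for x
  proof -
    have lin: "height u h (p + w) - height u h' (p + w) = a + w \<bullet> (inward h u - inward h' u)" for w
      by (simp add: height_def a_def inner_add_left inner_diff_left inner_diff_right)
    show ?thesis unfolding lin by (simp add: c_def inner_sum_left)
  qed
  have "a \<noteq> 0 \<or> (\<exists>i\<in>{..<n}. c i \<noteq> 0)"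
  proof (rule ccontr)
    assume "\<not> (a \<noteq> 0 \<or> (\<exists>i\<in>{..<n}. c i \<noteq> 0))"
    then have zero: "a = 0" "\<And>i. i < n \<Longrightarrow> c i = 0" by auto
    \<comment> \<open>With all coefficients 0 the two heights would agree throughout the flat, in
      particular at a relatively interior point of \<open>h\<close>, which would then lie in
      \<open>h'\<close> too.\<close>
    have "rel_interior h \<noteq> {}"
      using hinge_simplex[OF hh(1)] simplex_nonempty convex_simplex rel_interior_eq_empty by blast
    then obtain q where q: "q \<in> rel_interior h" by blast
    then have qh: "q \<in> h" using rel_interior_subset by blast
    then have qu: "q \<in> u" using u by blast
    have "q \<in> affine hull u" using qu by (rule hull_inc)
    then obtain w where w: "w \<in> span (e ` {..<n})" "q = p + w" using fr by (auto simp: orthonormal_frame_iff)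
    have fam: "orthonormal_family n e" using fr by (simp add: orthonormal_frame_iff)
    have "q = p + (\<Sum>i<n. (w \<bullet> e i) *\<^sub>R e i)" using w orthonormal_family_expand[OF fam] by simp
    then have "height u h q - height u h' q = a + (\<Sum>i<n. (w \<bullet> e i) * c i)" using diff by metis
    then have "height u h' q = 0" using zero height_facet[OF hh(1) u(1,2) qh] by simp
    then have "q \<in> h'" using height_eq_0_imp[OF hh(2) u(1,3) qu] by blast
    then have "h \<subseteq> h'" using rel_interior_imp_subset hinge_in_K hh q by blast
    then show False using hinge_subset_eq[OF hh] h(3) by blast
  qed
  from affine_zero_set_null[OF finite_lessThan this]
  show ?thesis unfolding diff[symmetric] by simp
qed

text \<open>A point of the open simplex in no sector has its minimal height over two different
  facets, so it lies in one of finitely many null tie sets.\<close>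

lemma sector_complement_null:
  assumes u: "u \<in> k_simplices K n" and ex: "\<exists>h\<in>H. h \<subseteq> u"
    and A: "A \<subseteq> rel_interior u - (\<Union>h\<in>H. sector h)"
  shows "flat_volume n (affine hull u) A = 0"
proof -
  let ?M = "Pi\<^sub>M {..<n} (\<lambda>_. lborel :: real measure)"
  have "int n simplex u" using u by (simp add: k_simplices_def)
  then obtain p e where fr: "orthonormal_frame n (affine hull u) p e"
    using simplex_frame_exists by blast
  define Hu where "Hu = {h \<in> H. h \<subseteq> u}"
  have Hu: "finite Hu" "Hu \<noteq> {}" using finite_H ex by (auto simp: Hu_def)
  define P where "P = {(h, h') \<in> Hu \<times> Hu. h \<noteq> h'}"
  have "finite P" using Hu(1) by (auto simp: P_def intro: finite_subset[of _ "Hu \<times> Hu"])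
  let ?T = "\<lambda>(h, h'). {x \<in> space ?M.
      height u h (p + (\<Sum>i<n. x i *\<^sub>R e i)) = height u h' (p + (\<Sum>i<n. x i *\<^sub>R e i))}"
  have tie: "\<exists>(h, h') \<in> P. height u h x = height u h' x"
    if x: "x \<in> rel_interior u" "x \<notin> (\<Union>h\<in>H. sector h)" for x
  proof (rule ccontr)
    assume no: "\<not> (\<exists>(h, h') \<in> P. height u h x = height u h' x)"
    obtain h where h: "h \<in> Hu" "\<And>h'. h' \<in> Hu \<Longrightarrow> height u h x \<le> height u h' x"
      using arg_min_if_finite[OF Hu, of "\<lambda>h. height u h x"] by (metis linorder_not_less)
    have hH: "h \<in> H" "h \<subseteq> u" using h by (auto simp: Hu_def)
    have strict: "height u h x < height u h' x" if "h' \<in> Hu" "h' \<noteq> h" for h'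
      using h(2)[OF that(1)] no h(1) that by (force simp: P_def)
    have uK: "u \<in> K" using u by (simp add: k_simplices_def)
    have "x \<in> star K h" using x(1) hH(2) uK by (auto simp: star_iff)
    moreover have "\<not> height u' h' x \<le> height u' h x"
      if "h' \<in> H - {h}" "u' \<in> k_simplices K n" "h \<subseteq> u'" "h' \<subseteq> u'" "x \<in> u'" for h' u'
    proof -
      \<comment> \<open>\<open>x\<close> is in the open simplex \<open>u\<close>, so
        \<open>u\<close> is the only n-simplex whose comparison of heights concerns it.\<close>
      have "u \<subseteq> u'" using rel_interior_imp_subset[OF uK _ x(1)] that by (simp add: k_simplices_def)
      then have "u = u'" using k_simplices_subset_eq u that by blast
      then show ?thesis using strict[of h'] that by (auto simp: Hu_def)
    qed
    ultimately have "x \<in> sector h" unfolding sector_def by blast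
    then show False using x(2) hH(1) by blast
  qed
  have "?T hh \<in> null_sets ?M" if "hh \<in> P" for hh
    using that height_tie_null[OF _ _ _ u _ _ fr] by (auto simp: P_def Hu_def)
  then have N: "(\<Union>hh\<in>P. ?T hh) \<in> null_sets ?M" using \<open>finite P\<close> by (intro null_sets_UN') (auto simp: countable_finite)
  have "{x \<in> {..<n} \<rightarrow>\<^sub>E UNIV. p + (\<Sum>i<n. x i *\<^sub>R e i) \<in> A} \<subseteq> (\<Union>hh\<in>P. ?T hh)"
  proof
    fix x assume x: "x \<in> {x \<in> {..<n} \<rightarrow>\<^sub>E UNIV. p + (\<Sum>i<n. x i *\<^sub>R e i) \<in> A}"
    then obtain h h' where "(h, h') \<in> P"
      "height u h (p + (\<Sum>i<n. x i *\<^sub>R e i)) = height u h' (p + (\<Sum>i<n. x i *\<^sub>R e i))"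
      using tie[of "p + (\<Sum>i<n. x i *\<^sub>R e i)"] A by blast
    then show "x \<in> (\<Union>hh\<in>P. ?T hh)" using x by (intro UN_I[of "(h, h')"]) (auto simp: space_PiM)
  qed
  then have "emeasure ?M {x \<in> {..<n} \<rightarrow>\<^sub>E UNIV. p + (\<Sum>i<n. x i *\<^sub>R e i) \<in> A}
     \<le> emeasure ?M (\<Union>hh\<in>P. ?T hh)"
    using N by (intro emeasure_mono) auto
  also have "\<dots> = 0" using N by auto
  finally show ?thesis unfolding flat_volume_eq[OF fr] by simp
qed

lemma integral_exists: "\<exists>I. has_mean_curvature_integral n K N (V v) I"
proof -
  \<comment> \<open>The region may spread over n-simplices that have no facet in the star of
    \<open>v\<close> and hence belong to no sector. Their open interiors meet no hinge, and taking
    them as one piece keeps the family finite.\<close>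
  define R where "R = V v \<inter> (\<Union>u \<in> {u \<in> k_simplices K n. \<forall>h\<in>H. \<not> h \<subseteq> u}. rel_interior u)"
  define \<D> where "\<D> = insert R ((\<lambda>h. V v \<inter> sector h) ` H)"
  \<comment> \<open>The value is a function of the set and not of the hinge that produced it, so
    pieces that coincide, such as empty ones, cause no conflict.\<close>
  define c where "c D = (\<Sum>h\<in>H. hinge_volume h D * hinge_angle n K N h)" for D
  have R_open: "openin (top_of_set (\<Union>K)) R"
    unfolding R_def
  proof (intro openin_Int V_open openin_Union)
    fix S assume "S \<in> rel_interior ` {u \<in> k_simplices K n. \<forall>h\<in>H. \<not> h \<subseteq> u}"
    then obtain u where "u \<in> k_simplices K n" "S = rel_interior u" by blast
    then show "openin (top_of_set (\<Union>K)) S" using star_open[of u] top_simplex_star[of u] by simp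
  qed
  have open_D: "openin (top_of_set (\<Union>K)) D" if "D \<in> \<D>" for D
    using that R_open sector_open V_open by (auto simp: \<D>_def)
  have sub: "\<Union>\<D> \<subseteq> V v" by (auto simp: \<D>_def R_def)
  have R_sector: "R \<inter> sector h = {}" if "h \<in> H" for h
  proof (rule ccontr)
    assume "R \<inter> sector h \<noteq> {}"
    then obtain x where "x \<in> R" "x \<in> sector h" by blast
    then have "x \<in> star K h" by (simp add: sector_def)
    then obtain f where f: "f \<in> K" "h \<subseteq> f" "x \<in> rel_interior f" by (auto simp: star_iff)
    obtain u where x: "u \<in> k_simplices K n" "\<not> h \<subseteq> u" "x \<in> rel_interior u"
      using \<open>x \<in> R\<close> \<open>h \<in> H\<close> by (auto simp: R_def)
    have "u \<in> K" using x(1) by (simp add: k_simplices_def)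
    then have "f = u" using rel_interior_unique[OF f(1) _ f(3) x(3)] by blast
    then show False using x f by blast
  qed
  have dis: "disjoint \<D>"
    unfolding \<D>_def disjoint_def using R_sector sector_disjoint by blast
  have piece: "has_piece_integral n K N D (c D)" if D: "D \<in> \<D>" for D
  proof -
    have "\<exists>I. has_piece_integral n K N D I"
    proof (cases "D = R")
      case True
      have "R \<inter> rel_interior h = {}" if "h \<in> hinges n K" for h
        using rel_interior_hinge_disjoint_top[OF that] by (auto simp: R_def)
      then show ?thesis using True by (auto simp: has_piece_integral_def)
    next
      case False
      then obtain h where h: "h \<in> H" "D = V v \<inter> sector h" using D by (auto simp: \<D>_def)
      obtain s t where st: "hinge_pair n K h s t" using hinge_pair_exists[OF H_hinges[OF h(1)]] by blast
      obtain p e where "hinge_frame n h s p e" using hinge_frame_exists[OF st] by blast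
      moreover have "D \<subseteq> star K h" using h by (auto simp: sector_def)
      ultimately show ?thesis using st unfolding has_piece_integral_def by blast
    qed
    then obtain I where I: "has_piece_integral n K N D I" by blast
    \<comment> \<open>It is enough that some integral of the piece exists; its value is already
      known from \<open>piece_value\<close>.\<close>
    moreover have "I = c D" unfolding c_def using piece_value[OF I _ open_D[OF D]] sub D by blast
    ultimately show ?thesis by simp
  qed
  have null: "flat_volume n (affine hull u) ((V v - \<Union>\<D>) \<inter> rel_interior u) = 0" if u: "u \<in> k_simplices K n" for u
  proof (cases "\<exists>h\<in>H. h \<subseteq> u")
    case True
    then show ?thesis by (rule sector_complement_null[OF u]) (auto simp: \<D>_def)
  next
    case False
    then have "(V v - \<Union>\<D>) \<inter> rel_interior u = {}" using u by (auto simp: \<D>_def R_def)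
    then show ?thesis using flat_volume_empty[of n u] u by (simp add: k_simplices_def)
  qed
  then have "pf_volume n K (V v - \<Union>\<D>) = 0" unfolding pf_volume_def by (intro infsum_0)
  moreover have "flat_volume (n - 1) (affine hull h) (rel_interior h \<inter> (V v - \<Union>\<D>)) = 0" if h: "h \<in> hinges n K" for h
  proof -
    have "rel_interior h \<inter> (V v - \<Union>\<D>) = {}"
    proof (cases "h \<in> H")
      case True
      then show ?thesis using rel_interior_subset_sector[OF True] by (auto simp: \<D>_def)
    next
      case False
      then show ?thesis using V_hinge[OF h] by blast
    qed
    then show ?thesis by (simp add: flat_volume_empty[OF hinge_simplex[OF h]] del: One_nat_def)
  qed
  moreover have "finite \<D>" using finite_H by (simp add: \<D>_def)
  ultimately show ?thesis
    unfolding has_mean_curvature_integral_def using dis sub open_D piece by blast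
qed

lemma mean_curvature_integral_eq:
  "mean_curvature_integral n K N (V v) = (\<Sum>h\<in>H. hinge_volume h (V v) * hinge_angle n K N h)"
  unfolding mean_curvature_integral_def
  using integral_exists integral_value by (metis (no_types, lifting) the_equality)

end

theorem theorem8:
  fixes n :: nat
    and K :: "(real ^ 'm) set set"
    and N :: "(real ^ 'm) set \<Rightarrow> real ^ 'm"
    and V :: "real ^ 'm \<Rightarrow> (real ^ 'm) set"
    and v :: "real ^ 'm"
  assumes "n \<ge> 1"
    and "piecewise_flat_submanifold n K"
    and "positive_normal n K N"
    and "dual_tessellation n K V"
    and "v \<in> vertices K"
  shows "average_mean_curvature n K N (V v) =
    1 / enn2real (pf_volume n K (V v)) *
      (\<Sum>h \<in> hinges_in_star n K v.
         enn2real (flat_volume (n - 1) (affine hull h) (rel_interior h \<inter> V v)) *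
         hinge_angle n K N h)"
proof -
  interpret vertex_region K n N V v
    using assms by unfold_locales (simp_all add: piecewise_flat_submanifold_def)
  show ?thesis
    unfolding average_mean_curvature_def mean_curvature_integral_eq hinge_volume_def ..
qed

end
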